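(* Consider a parameterized MDP with finite state space $\mathcal{S}$, finite action space $\mathcal{A}$ and finite parameter set $\Theta$, with optimal stationary policies $\mu_\theta^*$, $\theta\in\Theta$ (all as in the context). Assume: (1) for each $\theta\in\Theta$, the state process $\{S_t : t\ge 0\}$ induced by $\mu_\theta^*$ (under parameter $\theta$) is ergodic unichain; (2) there exists $s^*\in\mathcal{S}$ such that $\mu_\theta^*(s^* )$ is an informative action in state $s^*$ for all $\theta\in\Theta$; (3) there exists a stationary policy $\bar\mu\in\Pi_S$ such that the Markov chain induced by $\bar\mu$ is ergodic, and $N^{\mu}(t;s^* )\ge N^{\bar\mu}(t;s^* )$ holds (with probability 1) for all $t$ and all $\mu\in\Pi_C$. Then Thompson sampling achieves a worst-case average regret of $O(T^{-1})$, where $T$ is the number of decision epochs.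
   Context: Parameterized MDP: finite sets $\mathcal{S}$ (states), $\mathcal{A}$ (actions), $\Theta$ (parameters). Under parameter $\theta$, if action $a_t$ is applied in state $s_t$ at time $t$, the next state and the reward are sampled as $S_{t+1}\sim p_\theta(\cdot\mid s_t,a_t)$ and $R_t\sim q_\theta(\cdot\mid s_t,a_t)$. The reward function $r_\theta(s,a)=\mathbb{E}_\theta[R\mid s,a]=\int r\,q_\theta(r\mid s,a)\,dr$ is assumed uniformly bounded on $\mathcal{S}\times\mathcal{A}$. $\mathbb{E}_\theta$ denotes expectation when the true parameter is $\theta$. Policies: the history is $H_t=(S_0,A_0,R_0,\dots,S_{t-1},A_{t-1},R_{t-1},S_t)$. An admissible policy $\mu$ is a sequence $(\mu_t)_{t\ge0}$ of mappings from the history $H_t$ to probability distributions on $\mathcal{A}$; $\Pi$ is the set of admissible policies. A Markov policy is a sequence of maps $\mu_t:\mathcal{S}\to\mathcal{A}$; it is stationary if $\mu_0=\mu_1=\cdots$, and $\Pi_S$ is the set of stationary policies. For fixed $\theta$, the goal is to maximize over $\mu\in\Pi$ the long-run expected average reward $J_\theta^\mu(s_0)=\limsup_{T\to\infty}\frac1T\mathbb{E}_\theta\big[\sum_{t=0}^{T-1}r_\theta(S_t,A_t)\big]$ from the initial state $S_0=s_0$, with actions $A_t$ sampled according to $\mu$. An optimal policy $\mu_\theta^*$ is assumed to exist, and is a stationary Markov policy. Informative actions: $\nu_\theta(s,a)$ is the joint distribution of reward and next state specified by $q_\theta(\cdot\mid s,a)\,p_\theta(\cdot\mid s,a)$, and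 the KL-divergence is $\mathcal{K}(\nu_\theta(s,a)\,|\,\nu_\gamma(s,a))=\mathbb{E}_\theta\Big[\log\frac{q_\theta(\cdot\mid s,a)\,p_\theta(\cdot\mid s,a)}{q_\gamma(\cdot\mid s,a)\,p_\gamma(\cdot\mid s,a)}\Big]$. It is required that $\nu_\gamma(s,a)$ is absolutely continuous with respect to $\nu_\theta(s,a)$, so that this quantity is finite. An action $a$ is informative in state $s$ if $\mathcal{K}(\nu_\theta(s,a)\,|\,\nu_\gamma(s,a))>0$ for any two distinct $\theta,\gamma\in\Theta$. Counts: for a policy $\mu\in\Pi$ and $s\in\mathcal{S}$, with the states $S_i$ evolving under $\mu$, $N^\mu(t;s)=\sum_{i=0}^{t-1}\mathbf{1}\{S_i=s\}$. $\Pi_C$: let $\mathcal{A}^*(s)=\{a\in\mathcal{A}: a=\mu_\theta^*(s)\text{ for some }\theta\in\Theta\}$; $\Pi_C\subset\Pi$ is the set of policies $\mu$ for which $\mu(s)\in\mathcal{A}^*(s)$ for all $s\in\mathcal{S}$. Policies in $\Pi_C$ may be history-dependent; in particular the Thompson sampling policy belongs to $\Pi_C$. Thompson sampling: given a prior $\pi_0$ on $\Theta$, let $\pi_t(\theta)=\frac{\mathcal{L}_\theta(H_t)\pi_0(\theta)}{\sum_{\gamma\in\Theta}\mathcal{L}_\gamma(H_t)\pi_0(\gamma)}$ with likelihood $\mathcal{L}_\theta(H_t)=\prod_{i=1}^t q_\theta(R_{i-1}\mid S_{i-1},A_{i-1})\,p_\theta(S_i\mid S_{i-1},A_{i-1})$.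 At each time $t$, sample $\theta_t\sim\pi_t$ and apply $A_t=\mu_{\theta_t}^*(S_t)$. Regret: the term "worst-case average regret" is used without an explicit formula in the source (which elsewhere calls the bound an "expected regret bound"); it refers to the expected average-reward shortfall of Thompson sampling relative to the optimal policy $\mu_\theta^*$ for the true parameter $\theta$.
   Formalization: The prior is assumed to give positive probability to every parameter in Θ; without this the claim fails, since a prior that excludes the true parameter can make Thompson sampling play a suboptimal action forever. *)

theory Defs
  imports "HOL-Probability.Probability" "HOL-Library.Landau_Symbols"
begin

section \<open>Parameterized MDPs\<close>

text \<open>
  States, actions and parameters are the elements of finite types. Next states are drawn from
  \<open>ptrans M \<theta> s a\<close> and rewards from the density \<open>rdens M \<theta> s a\<close> with respect to a fixed
  \<open>\<sigma>\<close>-finite measure \<open>rref M\<close> on the Borel sets of the reals. Lebesgue densities are the case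
  \<open>rref M = lborel\<close>; discrete rewards use counting measure on a countable set.
\<close>

record ('s, 'a, 'p) pmdp =
  ptrans :: "'p \<Rightarrow> 's \<Rightarrow> 'a \<Rightarrow> 's pmf"
  rref   :: "real measure"
  rdens  :: "'p \<Rightarrow> 's \<Rightarrow> 'a \<Rightarrow> real \<Rightarrow> real"

definition rdist :: "('s, 'a, 'p) pmdp \<Rightarrow> 'p \<Rightarrow> 's \<Rightarrow> 'a \<Rightarrow> real measure" where
  "rdist M \<theta> s a = density (rref M) (\<lambda>x. ennreal (rdens M \<theta> s a x))"

definition rmean :: "('s, 'a, 'p) pmdp \<Rightarrow> 'p \<Rightarrow> 's \<Rightarrow> 'a \<Rightarrow> real" where
  "rmean M \<theta> s a = (\<integral>x. x * rdens M \<theta> s a x \<partial>rref M)"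

definition outcome :: "('s, 'a, 'p) pmdp \<Rightarrow> 'p \<Rightarrow> 's \<Rightarrow> 'a \<Rightarrow> (real \<times> 's) measure" where
  "outcome M \<theta> s a = rdist M \<theta> s a \<Otimes>\<^sub>M measure_pmf (ptrans M \<theta> s a)"

text \<open>
  \<^const>\<open>absolutely_continuous\<close> \<open>N K\<close> says that \<open>K\<close> is absolutely continuous with respect to \<open>N\<close>.
\<close>

locale param_mdp =
  fixes M :: "('s::finite, 'a::finite, 'p::finite) pmdp"
  assumes sigma_finite_rref: "sigma_finite_measure (rref M)"
    and sets_rref: "sets (rref M) = sets borel"
    and rdens_measurable: "rdens M \<theta> s a \<in> borel_measurable (rref M)"
    and rdens_nonneg: "0 \<le> rdens M \<theta> s a x"
    and prob_space_rdist: "prob_space (rdist M \<theta> s a)"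
    and reward_integrable: "integrable (rref M) (\<lambda>x. x * rdens M \<theta> s a x)"
    and rmean_bounded: "\<exists>B. \<forall>\<theta> s a. \<bar>rmean M \<theta> s a\<bar> \<le> B"
    and outcome_ac: "absolutely_continuous (outcome M \<theta> s a) (outcome M \<gamma> s a)"

section \<open>Informative actions\<close>

text \<open>
  The library's \<open>KL_divergence b N K\<close> is the divergence of \<open>K\<close> from \<open>N\<close>, i.e. the expectation
  under \<open>K\<close> of \<open>log b (dK/dN)\<close>. For \<open>K\<close> absolutely continuous with respect to \<open>N\<close>, the negative
  part of the log-likelihood ratio is always integrable under \<open>K\<close>, so the divergence is infinite exactly when that expectation does not exist; the library's
  real-valued notion would be \<open>0\<close> there.
\<close>

definition KL :: "'b measure \<Rightarrow> 'b measure \<Rightarrow> ereal" where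
  "KL K N =
     (if integrable K (entropy_density (exp 1) N K) then ereal (KL_divergence (exp 1) N K) else \<infinity>)"

definition informative :: "('s, 'a, 'p) pmdp \<Rightarrow> 's \<Rightarrow> 'a \<Rightarrow> bool" where
  "informative M s a \<longleftrightarrow> (\<forall>\<theta> \<gamma>. \<theta> \<noteq> \<gamma> \<longrightarrow> KL (outcome M \<theta> s a) (outcome M \<gamma> s a) > 0)"

section \<open>Policies and the trajectory process\<close>

text \<open>
  Coordinate \<open>t\<close> of a trajectory is \<open>(S\<^sub>t, A\<^sub>t, R\<^sub>t)\<close>. The history \<open>H\<^sub>t\<close> is represented by
  the coordinates below \<open>t\<close> together with the current state, so that a policy is a function
  \<open>\<mu> t \<omega> s\<close> in which \<open>\<omega>\<close> ranges over \<open>space (past_space t)\<close>.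
\<close>

type_synonym ('s, 'a) traj = "nat \<Rightarrow> 's \<times> 'a \<times> real"
type_synonym ('s, 'a) policy = "nat \<Rightarrow> ('s, 'a) traj \<Rightarrow> 's \<Rightarrow> 'a pmf"

definition step_space :: "('s \<times> 'a \<times> real) measure" where
  "step_space = count_space UNIV \<Otimes>\<^sub>M (count_space UNIV \<Otimes>\<^sub>M borel)"

definition past_space :: "nat \<Rightarrow> ('s, 'a) traj measure" where
  "past_space t = PiM {0..<t} (\<lambda>_. step_space)"

definition traj_space :: "('s, 'a) traj measure" where
  "traj_space = PiM UNIV (\<lambda>_. step_space)"

definition state :: "('s, 'a) traj \<Rightarrow> nat \<Rightarrow> 's" where
  "state \<omega> i = fst (\<omega> i)"

definition action :: "('s, 'a) traj \<Rightarrow> nat \<Rightarrow> 'a" where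
  "action \<omega> i = fst (snd (\<omega> i))"

definition reward :: "('s, 'a) traj \<Rightarrow> nat \<Rightarrow> real" where
  "reward \<omega> i = snd (snd (\<omega> i))"

definition admissible :: "('s, 'a) policy \<Rightarrow> bool" where
  "admissible \<mu> \<longleftrightarrow> (\<forall>t s a. (\<lambda>\<omega>. pmf (\<mu> t \<omega> s) a) \<in> borel_measurable (past_space t))"

definition stationary :: "('s \<Rightarrow> 'a) \<Rightarrow> ('s, 'a) policy" where
  "stationary f = (\<lambda>t \<omega> s. return_pmf (f s))"

definition step_kernel ::
  "('s, 'a, 'p) pmdp \<Rightarrow> 'p \<Rightarrow> ('s, 'a) policy \<Rightarrow> 's \<Rightarrow> nat \<Rightarrow> ('s, 'a) traj \<Rightarrow> ('s \<times> 'a \<times> real) measure"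
where
  "step_kernel M \<theta> \<mu> s0 t \<omega> =
     measure_pmf
       (bind_pmf (if t = 0 then return_pmf s0 else ptrans M \<theta> (state \<omega> (t - 1)) (action \<omega> (t - 1)))
         (\<lambda>s. map_pmf (Pair s) (\<mu> t \<omega> s)))
     \<bind> (\<lambda>(s, a). distr (rdist M \<theta> s a) step_space (\<lambda>r. (s, a, r)))"

text \<open>The infinite composition of the step kernels (Ionescu-Tulcea), a measure on \<open>traj_space\<close>.\<close>

definition traj_law ::
  "('s, 'a, 'p) pmdp \<Rightarrow> 'p \<Rightarrow> ('s, 'a) policy \<Rightarrow> 's \<Rightarrow> ('s, 'a) traj measure"
where
  "traj_law M \<theta> \<mu> s0 =
     projective_family.lim UNIV
       (Ionescu_Tulcea.CI (step_kernel M \<theta> \<mu> s0) (\<lambda>_. step_space)) (\<lambda>_. step_space)"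

definition expected_reward ::
  "('s, 'a, 'p) pmdp \<Rightarrow> 'p \<Rightarrow> ('s, 'a) policy \<Rightarrow> 's \<Rightarrow> nat \<Rightarrow> real"
where
  "expected_reward M \<theta> \<mu> s0 T =
     (\<integral>\<omega>. (\<Sum>t<T. rmean M \<theta> (state \<omega> t) (action \<omega> t)) \<partial>traj_law M \<theta> \<mu> s0)"

definition average_reward ::
  "('s, 'a, 'p) pmdp \<Rightarrow> 'p \<Rightarrow> ('s, 'a) policy \<Rightarrow> 's \<Rightarrow> ereal"
where
  "average_reward M \<theta> \<mu> s0 = limsup (\<lambda>T. ereal (expected_reward M \<theta> \<mu> s0 T / real T))"

definition optimal_policy :: "('s, 'a, 'p) pmdp \<Rightarrow> 'p \<Rightarrow> ('s, 'a) policy \<Rightarrow> bool" where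
  "optimal_policy M \<theta> \<mu> \<longleftrightarrow> admissible \<mu> \<and>
     (\<forall>\<mu>'. admissible \<mu>' \<longrightarrow> (\<forall>s. average_reward M \<theta> \<mu>' s \<le> average_reward M \<theta> \<mu> s))"

section \<open>Finite Markov chains\<close>

definition induced_chain :: "('s, 'a, 'p) pmdp \<Rightarrow> 'p \<Rightarrow> ('s \<Rightarrow> 'a) \<Rightarrow> 's \<Rightarrow> 's pmf" where
  "induced_chain M \<theta> f s = ptrans M \<theta> s (f s)"

definition nstep :: "('s \<Rightarrow> 's pmf) \<Rightarrow> nat \<Rightarrow> 's \<Rightarrow> 's pmf" where
  "nstep K n s = ((\<lambda>P. bind_pmf P K) ^^ n) (return_pmf s)"

definition reachable :: "('s \<Rightarrow> 's pmf) \<Rightarrow> 's \<Rightarrow> 's \<Rightarrow> bool" where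
  "reachable K s s' \<longleftrightarrow> (\<exists>n. pmf (nstep K n s) s' > 0)"

definition recurrent_class :: "('s \<Rightarrow> 's pmf) \<Rightarrow> 's set \<Rightarrow> bool" where
  "recurrent_class K C \<longleftrightarrow> C \<noteq> {} \<and> (\<forall>s\<in>C. {s'. reachable K s s'} = C)"

definition period :: "('s \<Rightarrow> 's pmf) \<Rightarrow> 's \<Rightarrow> nat" where
  "period K s = Gcd {n. n > 0 \<and> pmf (nstep K n s) s > 0}"

text \<open>
  A unichain has one recurrent class and possibly transient states; it is called ergodic if the
  recurrent class is aperiodic. An ergodic chain (without the qualifier) is irreducible and
  aperiodic. All notions are for finite state spaces, where closed communicating classes are
  positive recurrent.
\<close>

definition ergodic_unichain :: "('s \<Rightarrow> 's pmf) \<Rightarrow> bool" where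
  "ergodic_unichain K \<longleftrightarrow>
     (\<exists>!C. recurrent_class K C) \<and> (\<forall>C s. recurrent_class K C \<longrightarrow> s \<in> C \<longrightarrow> period K s = 1)"

definition ergodic_chain :: "('s \<Rightarrow> 's pmf) \<Rightarrow> bool" where
  "ergodic_chain K \<longleftrightarrow> (\<forall>s s'. reachable K s s') \<and> (\<forall>s. period K s = 1)"

section \<open>Visit counts and candidate policies\<close>

definition visits :: "('s, 'a) traj \<Rightarrow> nat \<Rightarrow> 's \<Rightarrow> nat" where
  "visits \<omega> t s = card {i. i < t \<and> state \<omega> i = s}"

definition candidate_actions :: "('p \<Rightarrow> 's \<Rightarrow> 'a) \<Rightarrow> 's \<Rightarrow> 'a set" where
  "candidate_actions mu_opt s = {a. \<exists>\<theta>. a = mu_opt \<theta> s}"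

definition candidate_policies :: "('p \<Rightarrow> 's \<Rightarrow> 'a) \<Rightarrow> ('s, 'a) policy set" where
  "candidate_policies mu_opt = {\<mu>. admissible \<mu> \<and>
     (\<forall>t. \<forall>\<omega>\<in>space (past_space t). \<forall>s. set_pmf (\<mu> t \<omega> s) \<subseteq> candidate_actions mu_opt s)}"

text \<open>
  An almost sure comparison of two processes needs them on one probability space; since each
  process is specified only through its law, this is expressed by a coupling of the two laws.
\<close>

definition coupling :: "'b measure \<Rightarrow> 'c measure \<Rightarrow> ('b \<times> 'c) measure \<Rightarrow> bool" where
  "coupling P P' Q \<longleftrightarrow> sets Q = sets (P \<Otimes>\<^sub>M P') \<and> distr Q P fst = P \<and> distr Q P' snd = P'"

definition visits_dominate ::
  "('s, 'a, 'p) pmdp \<Rightarrow> 'p \<Rightarrow> 's \<Rightarrow> 's \<Rightarrow> ('s, 'a) policy \<Rightarrow> ('s, 'a) policy \<Rightarrow> bool"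
where
  "visits_dominate M \<theta> s0 s \<mu> \<mu>' \<longleftrightarrow>
     (\<exists>Q. coupling (traj_law M \<theta> \<mu> s0) (traj_law M \<theta> \<mu>' s0) Q \<and>
          (AE (\<omega>, \<omega>') in Q. \<forall>t. visits \<omega> t s \<ge> visits \<omega>' t s))"

section \<open>Thompson sampling\<close>

definition likelihood :: "('s, 'a, 'p) pmdp \<Rightarrow> 'p \<Rightarrow> nat \<Rightarrow> ('s, 'a) traj \<Rightarrow> 's \<Rightarrow> real" where
  "likelihood M \<theta> t \<omega> s =
     (\<Prod>i<t. rdens M \<theta> (state \<omega> i) (action \<omega> i) (reward \<omega> i) *
        pmf (ptrans M \<theta> (state \<omega> i) (action \<omega> i)) (if Suc i < t then state \<omega> (Suc i) else s))"

text \<open>On the null event where the normalizing constant is zero, the prior is used.\<close>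

definition posterior ::
  "('s, 'a, 'p::finite) pmdp \<Rightarrow> 'p pmf \<Rightarrow> nat \<Rightarrow> ('s, 'a) traj \<Rightarrow> 's \<Rightarrow> 'p pmf"
where
  "posterior M prior t \<omega> s =
     (let Z = (\<Sum>\<gamma>\<in>UNIV. likelihood M \<gamma> t \<omega> s * pmf prior \<gamma>)
      in if Z = 0 then prior
         else embed_pmf (\<lambda>\<theta>. likelihood M \<theta> t \<omega> s * pmf prior \<theta> / Z))"

definition thompson ::
  "('s, 'a, 'p::finite) pmdp \<Rightarrow> ('p \<Rightarrow> 's \<Rightarrow> 'a) \<Rightarrow> 'p pmf \<Rightarrow> ('s, 'a) policy"
where
  "thompson M mu_opt prior =
     (\<lambda>t \<omega> s. map_pmf (\<lambda>\<theta>. mu_opt \<theta> s) (posterior M prior t \<omega> s))"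

section \<open>Regret\<close>

definition average_regret ::
  "('s, 'a, 'p::finite) pmdp \<Rightarrow> ('p \<Rightarrow> 's \<Rightarrow> 'a) \<Rightarrow> 'p pmf \<Rightarrow> 's \<Rightarrow> 'p \<Rightarrow> nat \<Rightarrow> real"
where
  "average_regret M mu_opt prior s0 \<theta> T =
     (expected_reward M \<theta> (stationary (mu_opt \<theta>)) s0 T
      - expected_reward M \<theta> (thompson M mu_opt prior) s0 T) / real T"

definition worst_case_average_regret ::
  "('s, 'a, 'p::finite) pmdp \<Rightarrow> ('p \<Rightarrow> 's \<Rightarrow> 'a) \<Rightarrow> 'p pmf \<Rightarrow> 's \<Rightarrow> nat \<Rightarrow> real"
where
  "worst_case_average_regret M mu_opt prior s0 T =
     Max (range (\<lambda>\<theta>. average_regret M mu_opt prior s0 \<theta> T))"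

end

theory Submission
  imports Defs
begin

text \<open>
  Under the true parameter \<open>\<theta>\<close>, the gain \<open>g\<close> and bias \<open>h\<close> of the unichain \<open>\<mu>\<^sub>\<theta>\<close> solve the Poisson
  equation \<open>r = g + h - P h\<close>. Telescoping \<open>h\<close> along the trajectory of any policy shows that its expected
  reward differs from \<open>T g\<close> by at most a constant plus a multiple of the expected number of
  times at which it does not play \<open>\<mu>\<^sub>\<theta>(S\<^sub>t)\<close>. It therefore suffices that the expected posterior mass of every
  wrong parameter \<open>\<gamma>\<close> decays geometrically. That mass is at most a constant times
  \<open>min 1 (sqrt (L\<^sub>\<gamma> / L\<^sub>\<theta>))\<close>. In the informative state every candidate action has Hellinger affinity at most
  some \<open>c < 1\<close>, so \<open>sqrt (L\<^sub>\<gamma> / L\<^sub>\<theta>) / c^N\<close>, where \<open>N\<close> counts the visits to that state, has expectation at most 1.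
  By the coupling, \<open>c^N\<close> is on average at most its value for the ergodic comparison chain, where it
  decays geometrically. Splitting at \<open>c^N \<le> l\<close> with \<open>l\<close> itself decaying geometrically combines the two bounds.
\<close>

section \<open>Trajectory laws of controlled processes\<close>

text \<open>In general \<open>CI J\<close> composes the kernels up to the least bound of
  \<open>J\<close> and then projects to \<open>J\<close>. For an initial segment the bound is
  \<open>n\<close> itself and the projection changes nothing.\<close>

lemma (in Ionescu_Tulcea) CI_atLeast0LessThan: "CI {0..<n} = C 0 n (\<lambda>_. undefined)"
proof -
  have le: "up_to {0..<n} \<le> n" and sub: "{0..<n} \<subseteq> {0..<up_to {0..<n}}"
    using up_to[of "{0..<n}"] by (auto simp: up_to_iff)
  then have eq: "up_to {0..<n} = n" by auto
  have "C 0 n (\<lambda>_. undefined) = distr (C 0 n (\<lambda>_. undefined)) (PiM {0..<0+n} M) (\<lambda>x. restrict x {0..<0+n})"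
    by (rule distr_C) (auto simp: space_PiM)
  then show ?thesis unfolding CI_def eq by simp
qed

lemma (in Ionescu_Tulcea) nn_integral_lim:
  assumes [measurable]: "f \<in> borel_measurable (PiM {0..<n} M)"
  shows "(\<integral>\<^sup>+\<omega>. f (restrict \<omega> {0..<n}) \<partial>PF.lim) = (\<integral>\<^sup>+\<omega>. f \<omega> \<partial>C 0 n (\<lambda>_. undefined))"
proof -
  have "(\<integral>\<^sup>+\<omega>. f \<omega> \<partial>C 0 n (\<lambda>_. undefined))
      = (\<integral>\<^sup>+\<omega>. f \<omega> \<partial>distr PF.lim (PiM {0..<n} M) (\<lambda>x. restrict x {0..<n}))"
    by (subst distr_lim) (simp_all only: CI_atLeast0LessThan finite_atLeastLessThan)
  also have "\<dots> = (\<integral>\<^sup>+\<omega>. f (restrict \<omega> {0..<n}) \<partial>PF.lim)"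
    by (intro nn_integral_distr) (auto intro!: measurable_restrict simp: measurable_cong_sets[OF PF.sets_lim refl])
  finally show ?thesis by simp
qed

text \<open>One-step conditioning. The composition up to \<open>Suc n\<close> binds the composition
  up to \<open>n\<close> with the kernel at \<open>n\<close>, so the last coordinate can be
  integrated out given the earlier ones. Restrictions appear because kernels take points of the
  product over the past.\<close>

lemma (in Ionescu_Tulcea) nn_integral_lim_Suc:
  assumes f[measurable]: "f \<in> borel_measurable (PiM {0..<Suc n} M)"
  shows "(\<integral>\<^sup>+\<omega>. f (restrict \<omega> {0..<Suc n}) \<partial>PF.lim)
    = (\<integral>\<^sup>+\<omega>. (\<integral>\<^sup>+x. f ((restrict \<omega> {0..<n})(n := x)) \<partial>P n (restrict \<omega> {0..<n})) \<partial>PF.lim)"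
proof -
  have sp: "(\<lambda>_. undefined) \<in> space (PiM {0..<0} M)" by (simp add: space_PiM)
  have "(\<integral>\<^sup>+\<omega>. f (restrict \<omega> {0..<Suc n}) \<partial>PF.lim) = (\<integral>\<^sup>+\<omega>. f \<omega> \<partial>C 0 (Suc n) (\<lambda>_. undefined))"
    by (rule nn_integral_lim) fact
  also have "\<dots> = (\<integral>\<^sup>+\<omega>. (\<integral>\<^sup>+x. f x \<partial>eP n \<omega>) \<partial>C 0 n (\<lambda>_. undefined))"
    using measurable_eP[of n] measurable_C[of 0 n]
    by (simp add: nn_integral_bind[where B="PiM {0..<Suc n} M"] measurable_cong_sets[OF sets_C[OF sp] refl])
  also have "\<dots> = (\<integral>\<^sup>+\<omega>. (\<integral>\<^sup>+x. f x \<partial>eP n (restrict \<omega> {0..<n})) \<partial>PF.lim)"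
    using measurable_eP[of n]
    by (intro nn_integral_lim[symmetric] measurable_compose[OF measurable_eP nn_integral_measurable_subprob_algebra]) auto
  also have "\<dots> = (\<integral>\<^sup>+\<omega>. (\<integral>\<^sup>+x. f ((restrict \<omega> {0..<n})(n := x)) \<partial>P n (restrict \<omega> {0..<n})) \<partial>PF.lim)"
    by (intro nn_integral_cong nn_integral_eP f) (auto simp: space_PiM PF.space_lim)
  finally show ?thesis .
qed

text \<open>A pushforward keeps the total mass, and the projection to the empty index set already
  has mass one.\<close>

lemma (in Ionescu_Tulcea) prob_space_lim: "prob_space PF.lim"
proof -
  have "prob_space (distr PF.lim (PiM {0..<0} M) (\<lambda>x. restrict x {0..<0}))"
    by (simp only: distr_lim finite_atLeastLessThan CI_atLeast0LessThan) (rule prob_space_C, simp add: space_PiM)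
  then show ?thesis
    by (rule prob_space_distrD[rotated])
       (auto intro!: measurable_restrict simp: measurable_cong_sets[OF PF.sets_lim refl])
qed

section \<open>Measurability of states, actions and rewards\<close>

lemma space_step_space [simp]: "space step_space = UNIV"
  by (auto simp: step_space_def space_pair_measure)

lemma space_traj_space [simp]: "space traj_space = UNIV"
  by (auto simp: traj_space_def space_PiM)

lemma measurable_step_space [measurable]:
  "fst \<in> measurable step_space (count_space UNIV)"
  "(\<lambda>x. fst (snd x)) \<in> measurable step_space (count_space UNIV)"
  "(\<lambda>x. snd (snd x)) \<in> measurable step_space borel"
  unfolding step_space_def by measurable

lemma measurable_coordinates:
  assumes "i \<in> I"
  shows "(\<lambda>\<omega>. state \<omega> i) \<in> measurable (PiM I (\<lambda>_. step_space)) (count_space UNIV)"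
    and "(\<lambda>\<omega>. action \<omega> i) \<in> measurable (PiM I (\<lambda>_. step_space)) (count_space UNIV)"
    and "(\<lambda>\<omega>. reward \<omega> i) \<in> measurable (PiM I (\<lambda>_. step_space)) borel"
  unfolding state_def action_def reward_def
  using measurable_step_space[THEN measurable_compose[OF measurable_component_singleton[OF assms]]]
  by simp_all

lemma measurable_past [measurable (raw)]:
  assumes "i < n"
  shows "(\<lambda>\<omega>. state \<omega> i) \<in> measurable (past_space n) (count_space UNIV)"
    and "(\<lambda>\<omega>. action \<omega> i) \<in> measurable (past_space n) (count_space UNIV)"
    and "(\<lambda>\<omega>. reward \<omega> i) \<in> measurable (past_space n) borel"
  unfolding past_space_def using assms by (auto intro!: measurable_coordinates)

lemma measurable_traj [measurable (raw)]:
  shows "(\<lambda>\<omega>. state \<omega> i) \<in> measurable traj_space (count_space UNIV)"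
    and "(\<lambda>\<omega>. action \<omega> i) \<in> measurable traj_space (count_space UNIV)"
    and "(\<lambda>\<omega>. reward \<omega> i) \<in> measurable traj_space borel"
  unfolding traj_space_def by (auto intro!: measurable_coordinates)

lemma pmf_bind_Pair:
  "pmf (bind_pmf p (\<lambda>s. map_pmf (Pair s) (q s))) (s, a) = pmf p s * pmf (q s) a"
proof -
  have eq: "pmf (map_pmf (Pair s') (q s')) (s, a) = indicator {s} s' * pmf (q s) a" for s'
  proof (cases "s' = s")
    case True
    then show ?thesis by (simp add: pmf_map_inj' inj_def)
  next
    case False
    then show ?thesis by (subst pmf_map_outside) auto
  qed
  show ?thesis
    unfolding pmf_bind eq
    by (simp add: measure_pmf_single)
qed

section \<open>The process under one parameter and one policy\<close>

locale controlled_mdp = param_mdp M for M :: "('s::finite, 'a::finite, 'p::finite) pmdp" +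
  fixes \<theta> :: 'p and \<mu> :: "('s, 'a) policy" and s0 :: 's
  assumes admissible: "admissible \<mu>"
begin

lemma sets_rdist [measurable_cong]: "sets (rdist M \<gamma> s a) = sets borel"
  by (simp add: rdist_def sets_rref)

lemma space_rdist [simp]: "space (rdist M \<gamma> s a) = UNIV"
  using sets_eq_imp_space_eq[OF sets_rdist] by simp

lemma measurable_policy [measurable]:
  "(\<lambda>\<omega>. pmf (\<mu> n \<omega> s) a) \<in> borel_measurable (past_space n)"
  using admissible by (simp add: admissible_def)

abbreviation law :: "('s, 'a) traj measure" where
  "law \<equiv> traj_law M \<theta> \<mu> s0"

text \<open>The conditional law of the state at time \<open>n\<close> given the past. Reading time 0
  as a point mass at \<open>s0\<close> makes the one-step identities uniform in \<open>n\<close>, so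
  that inductions can start at 0.\<close>

definition next_state :: "nat \<Rightarrow> ('s, 'a) traj \<Rightarrow> 's pmf" where
  "next_state n \<omega> = (if n = 0 then return_pmf s0 else ptrans M \<theta> (state \<omega> (n - 1)) (action \<omega> (n - 1)))"

lemma next_state_restrict [simp]: "next_state n (restrict \<omega> {0..<n}) = next_state n \<omega>"
  by (auto simp: next_state_def state_def action_def)

lemma measurable_next_state [measurable]:
  "(\<lambda>\<omega>. pmf (next_state n \<omega>) s) \<in> borel_measurable (past_space n)"
proof (cases n)
  case (Suc k)
  have eq: "count_space UNIV = (count_space UNIV \<Otimes>\<^sub>M count_space UNIV :: ('s \<times> 'a) measure)"
    by (simp add: pair_measure_countable countable_finite)
  have "(\<lambda>\<omega> :: ('s, 'a) traj. (state \<omega> k, action \<omega> k)) \<in> measurable (past_space n) (count_space UNIV)"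
    unfolding eq using Suc by (intro measurable_Pair measurable_past) auto
  from measurable_compose[OF this, of "\<lambda>(x, b). pmf (ptrans M \<theta> x b) s"]
  have "(\<lambda>\<omega>. (\<lambda>(x, b). pmf (ptrans M \<theta> x b) s) (state \<omega> k, action \<omega> k)) \<in> borel_measurable (past_space n)"
    by simp
  then show ?thesis using Suc by (simp add: next_state_def)
qed (simp add: next_state_def)

lemma measurable_reward: "(\<lambda>r. (s, a, r)) \<in> measurable (rdist M \<gamma> s' a') step_space"
  by (simp add: step_space_def)

lemma measurable_reward_kernel:
  "(\<lambda>(s, a). distr (rdist M \<theta> s a) step_space (\<lambda>r. (s, a, r)))
     \<in> measurable (count_space UNIV) (subprob_algebra step_space)"
proof -
  have "distr (rdist M \<theta> s a) step_space (\<lambda>r. (s, a, r)) \<in> space (subprob_algebra step_space)" for s a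
    unfolding space_subprob_algebra
    by (auto intro!: prob_space_imp_subprob_space prob_space.prob_space_distr prob_space_rdist measurable_reward)
  then show ?thesis by (auto simp: measurable_count_space_eq1)
qed

lemma step_kernel_eq:
  "step_kernel M \<theta> \<mu> s0 n \<omega> =
     measure_pmf (bind_pmf (next_state n \<omega>) (\<lambda>s. map_pmf (Pair s) (\<mu> n \<omega> s)))
     \<bind> (\<lambda>(s, a). distr (rdist M \<theta> s a) step_space (\<lambda>r. (s, a, r)))"
  by (simp add: step_kernel_def next_state_def)

text \<open>There are finitely many state-action pairs, so measurability in the past reduces to that
  of the point masses, which are products of a transition and a policy probability.\<close>

lemma measurable_step_kernel:
  "step_kernel M \<theta> \<mu> s0 n \<in> measurable (past_space n) (subprob_algebra step_space)"
proof -
  let ?X = "\<lambda>\<omega>. measure_pmf (bind_pmf (next_state n \<omega>) (\<lambda>s. map_pmf (Pair s) (\<mu> n \<omega> s)))"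
  have "?X \<in> measurable (past_space n) (subprob_algebra (count_space UNIV))"
  proof (rule measurable_subprob_algebra)
    fix A :: "('s \<times> 'a) set"
    have "(\<lambda>\<omega>. emeasure (?X \<omega>) A)
        = (\<lambda>\<omega>. \<Sum>(s, a)\<in>A. ennreal (pmf (next_state n \<omega>) s * pmf (\<mu> n \<omega> s) a))"
      unfolding emeasure_measure_pmf_finite[OF finite]
      by (auto simp: pmf_bind_Pair simp flip: sum_ennreal intro!: sum.cong)
    also have "\<dots> \<in> borel_measurable (past_space n)"
      unfolding split_beta by measurable
    finally show "(\<lambda>\<omega>. emeasure (?X \<omega>) A) \<in> borel_measurable (past_space n)" .
  qed (auto intro: measure_pmf.subprob_space_axioms)
  then show ?thesis
    unfolding step_kernel_eq
    by (rule measurable_bind2[OF _ measurable_reward_kernel])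
qed

lemma nn_integral_step_kernel:
  assumes [measurable]: "f \<in> borel_measurable step_space"
  shows "(\<integral>\<^sup>+x. f x \<partial>step_kernel M \<theta> \<mu> s0 n \<omega>)
    = (\<Sum>s\<in>UNIV. \<Sum>a\<in>UNIV. ennreal (pmf (next_state n \<omega>) s * pmf (\<mu> n \<omega> s) a)
          * (\<integral>\<^sup>+r. f (s, a, r) \<partial>rdist M \<theta> s a))"
proof -
  let ?p = "bind_pmf (next_state n \<omega>) (\<lambda>s. map_pmf (Pair s) (\<mu> n \<omega> s))"
  have "(\<integral>\<^sup>+x. f x \<partial>step_kernel M \<theta> \<mu> s0 n \<omega>)
     = (\<integral>\<^sup>+x. (\<integral>\<^sup>+y. f y \<partial>(case x of (s, a) \<Rightarrow> distr (rdist M \<theta> s a) step_space (\<lambda>r. (s, a, r)))) \<partial>measure_pmf ?p)"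
    unfolding step_kernel_eq
    by (rule nn_integral_bind[where B=step_space]) (use measurable_reward_kernel in \<open>auto simp: measurable_pmf_measure1\<close>)
  also have "\<dots> = (\<Sum>x\<in>UNIV. (\<integral>\<^sup>+y. f y \<partial>(case x of (s, a) \<Rightarrow> distr (rdist M \<theta> s a) step_space (\<lambda>r. (s, a, r)))) * pmf ?p x)"
    by (rule nn_integral_measure_pmf_support) auto
  also have "\<dots> = (\<Sum>(s, a)\<in>UNIV \<times> UNIV. (\<integral>\<^sup>+r. f (s, a, r) \<partial>rdist M \<theta> s a) * pmf ?p (s, a))"
    by (auto simp: UNIV_Times_UNIV nn_integral_distr[where M'=step_space] measurable_reward intro!: sum.cong)
  finally show ?thesis
    unfolding sum.cartesian_product[symmetric] by (simp add: pmf_bind_Pair mult.commute)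
qed

lemma prob_space_step_kernel: "prob_space (step_kernel M \<theta> \<mu> s0 n \<omega>)"
  unfolding step_kernel_eq using measurable_reward_kernel
  by (intro measure_pmf.prob_space_bind[where S=step_space])
     (auto intro!: prob_space.prob_space_distr prob_space_rdist AE_I2 measurable_reward simp: measurable_pmf_measure1)

sublocale IT: Ionescu_Tulcea "step_kernel M \<theta> \<mu> s0" "\<lambda>_. step_space"
  by (rule Ionescu_Tulcea.intro[OF measurable_step_kernel[unfolded past_space_def] prob_space_step_kernel])

lemma law_eq_lim: "law = IT.PF.lim"
  by (simp add: traj_law_def)

lemma sets_law [measurable_cong]: "sets law = sets traj_space"
  by (simp add: law_eq_lim IT.PF.sets_lim traj_space_def)

lemma space_law [simp]: "space law = UNIV"
  using sets_eq_imp_space_eq[OF sets_law] by simp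

sublocale law: prob_space law
  unfolding law_eq_lim by (rule IT.prob_space_lim)

text \<open>The controlled Markov property in integrated form. Assumption \<open>past\<close> says
  that \<open>F\<close> reads only coordinates below \<open>n\<close>, so updating coordinate
  \<open>n\<close> does not affect its first argument and a full trajectory may stand for its
  restriction.\<close>

lemma nn_integral_law_step:
  assumes F[measurable]: "(\<lambda>(\<omega>, x). F \<omega> x) \<in> borel_measurable (past_space n \<Otimes>\<^sub>M step_space)"
    and past: "\<And>\<omega>. F (restrict \<omega> {0..<n}) = F \<omega>"
  shows "(\<integral>\<^sup>+\<omega>. F \<omega> (\<omega> n) \<partial>law)
    = (\<integral>\<^sup>+\<omega>. (\<Sum>s\<in>UNIV. \<Sum>a\<in>UNIV. ennreal (pmf (next_state n \<omega>) s * pmf (\<mu> n (restrict \<omega> {0..<n}) s) a)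
          * (\<integral>\<^sup>+r. F \<omega> (s, a, r) \<partial>rdist M \<theta> s a)) \<partial>law)"
proof -
  let ?f = "\<lambda>\<omega>. F (restrict \<omega> {0..<n}) (\<omega> n)"
  have "(\<lambda>\<omega>. (restrict \<omega> {0..<n}, \<omega> n)) \<in> measurable (PiM {0..<Suc n} (\<lambda>_. step_space)) (past_space n \<Otimes>\<^sub>M step_space)"
    unfolding past_space_def by (intro measurable_Pair measurable_restrict measurable_component_singleton) auto
  from measurable_compose[OF this F]
  have [measurable]: "?f \<in> borel_measurable (PiM {0..<Suc n} (\<lambda>_. step_space))" by simp
  have "(\<integral>\<^sup>+\<omega>. F \<omega> (\<omega> n) \<partial>law) = (\<integral>\<^sup>+\<omega>. ?f (restrict \<omega> {0..<Suc n}) \<partial>law)"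
    by (simp add: past Int_absorb1)
  also have "\<dots> = (\<integral>\<^sup>+\<omega>. (\<integral>\<^sup>+x. ?f ((restrict \<omega> {0..<n})(n := x)) \<partial>step_kernel M \<theta> \<mu> s0 n (restrict \<omega> {0..<n})) \<partial>law)"
    unfolding law_eq_lim by (rule IT.nn_integral_lim_Suc) measurable
  also have "\<dots> = (\<integral>\<^sup>+\<omega>. (\<integral>\<^sup>+x. F (restrict \<omega> {0..<n}) x \<partial>step_kernel M \<theta> \<mu> s0 n (restrict \<omega> {0..<n})) \<partial>law)"
    by (intro nn_integral_cong) (simp add: past)
  also have "\<dots> = (\<integral>\<^sup>+\<omega>. (\<Sum>s\<in>UNIV. \<Sum>a\<in>UNIV. ennreal (pmf (next_state n (restrict \<omega> {0..<n})) s * pmf (\<mu> n (restrict \<omega> {0..<n}) s) a)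
          * (\<integral>\<^sup>+r. F (restrict \<omega> {0..<n}) (s, a, r) \<partial>rdist M \<theta> s a)) \<partial>law)"
  proof (intro nn_integral_cong nn_integral_step_kernel)
    fix \<omega> :: "('s, 'a) traj"
    have "restrict \<omega> {0..<n} \<in> space (past_space n)" by (auto simp: past_space_def space_PiM)
    from measurable_Pair2[OF F this] show "F (restrict \<omega> {0..<n}) \<in> borel_measurable step_space" by simp
  qed
  finally show ?thesis by (simp only: past next_state_restrict)
qed

end

section \<open>Finite Markov chains\<close>

lemma sum_pmf_UNIV: "(\<Sum>s\<in>UNIV. pmf p s) = 1" for p :: "'s::finite pmf"
  by (rule sum_pmf_eq_1) auto

lemma sum_pmf_le:
  fixes p :: "'s::finite pmf"
  assumes "\<And>s. f s \<le> c"
  shows "(\<Sum>s\<in>UNIV. pmf p s * f s) \<le> c"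
proof -
  have "(\<Sum>s\<in>UNIV. pmf p s * f s) \<le> (\<Sum>s\<in>UNIV. pmf p s * c)"
    by (intro sum_mono mult_left_mono assms) auto
  then show ?thesis by (simp add: sum_pmf_UNIV flip: sum_distrib_right)
qed

lemma finite_attains_max:
  fixes f :: "'a::finite \<Rightarrow> 'b::linorder"
  obtains x where "\<And>y. f y \<le> f x"
proof -
  have "Max (range f) \<in> range f" by (rule Max_in) auto
  then obtain x where "Max (range f) = f x" by (rule rangeE)
  then have "f y \<le> f x" for y using Max_ge[of "range f" "f y"] by simp
  then show thesis by (rule that)
qed

section \<open>Recurrent classes and the maximum principle\<close>

lemma reachable_iff_rtranclp: "reachable K s s' \<longleftrightarrow> (\<lambda>x y. y \<in> set_pmf (K x))\<^sup>*\<^sup>* s s'"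
proof
  have "s' \<in> set_pmf (nstep K n s) \<Longrightarrow> (\<lambda>x y. y \<in> set_pmf (K x))\<^sup>*\<^sup>* s s'" for n
  proof (induction n arbitrary: s')
    case (Suc n)
    then obtain y where "y \<in> set_pmf (nstep K n s)" "s' \<in> set_pmf (K y)"
      by (auto simp: nstep_def)
    with Suc.IH show ?case by (auto intro: rtranclp.rtrancl_into_rtrancl)
  qed (simp add: nstep_def)
  then show "reachable K s s' \<Longrightarrow> (\<lambda>x y. y \<in> set_pmf (K x))\<^sup>*\<^sup>* s s'"
    by (auto simp: reachable_def pmf_positive_iff)
next
  assume "(\<lambda>x y. y \<in> set_pmf (K x))\<^sup>*\<^sup>* s s'"
  then have "\<exists>n. s' \<in> set_pmf (nstep K n s)"
  proof induction
    case base
    have "s \<in> set_pmf (nstep K 0 s)" by (simp add: nstep_def)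
    then show ?case ..
  next
    case (step y z)
    then obtain n where "y \<in> set_pmf (nstep K n s)" by blast
    with step.hyps have "z \<in> set_pmf (nstep K (Suc n) s)" by (auto simp: nstep_def)
    then show ?case ..
  qed
  then show "reachable K s s'" by (auto simp: reachable_def pmf_positive_iff)
qed

lemma reachable_trans: "reachable K x y \<Longrightarrow> reachable K y z \<Longrightarrow> reachable K x z"
  by (auto simp: reachable_iff_rtranclp)

text \<open>Among the states reachable from \<open>s\<close>, one whose own reachable set has least
  cardinality generates a recurrent class: every state it reaches has a reachable set that is
  contained in its own and no smaller.\<close>

lemma recurrent_class_reachable:
  fixes K :: "'s::finite \<Rightarrow> 's pmf"
  shows "\<exists>C. recurrent_class K C \<and> C \<subseteq> {s'. reachable K s s'}"
proof -
  define R where "R x = {y. reachable K x y}" for x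
  obtain t where t: "t \<in> R s" and min: "\<And>y. y \<in> R s \<Longrightarrow> card (R t) \<le> card (R y)"
    using ex_has_least_nat[of "\<lambda>y. y \<in> R s" s "\<lambda>y. card (R y)"]
    by (auto simp: R_def reachable_iff_rtranclp)
  have "R y = R t" if "y \<in> R t" for y
  proof (rule card_subset_eq)
    show sub: "R y \<subseteq> R t" using that by (auto simp: R_def intro: reachable_trans)
    have "y \<in> R s" using t that by (auto simp: R_def intro: reachable_trans)
    from min[OF this] show "card (R y) = card (R t)"
      using card_mono[OF finite sub] by simp
  qed simp
  moreover have "t \<in> R t" by (simp add: R_def reachable_iff_rtranclp)
  ultimately have "recurrent_class K (R t)"
    unfolding recurrent_class_def R_def[symmetric] by blast
  moreover have "R t \<subseteq> R s" using t by (auto simp: R_def intro: reachable_trans)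
  ultimately show ?thesis by (auto simp: R_def)
qed

text \<open>Maximum principle. Where \<open>h\<close> is maximal, the average over successors can
  only reach \<open>h\<close> if every successor of positive probability is a maximiser too.
  Maximality thus spreads along paths until it fills a recurrent class.\<close>

lemma subharmonic_maximum:
  fixes K :: "'s::finite \<Rightarrow> 's pmf" and h :: "'s \<Rightarrow> real"
  assumes h: "\<And>s. h s \<le> (\<Sum>s'\<in>UNIV. pmf (K s) s' * h s')"
  obtains C where "recurrent_class K C" "\<And>s s'. s \<in> C \<Longrightarrow> h s' \<le> h s"
proof -
  obtain s where le: "\<And>y. h y \<le> h s" using finite_attains_max[of h] by blast
  define m where "m = h s"
  note le = le[folded m_def]
  have step: "h y = m" if "h x = m" "y \<in> set_pmf (K x)" for x y
  proof -
    have "(\<Sum>s'\<in>UNIV. pmf (K x) s' * (m - h s')) \<le> 0"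
      using h[of x] that by (simp add: right_diff_distrib sum_subtractf sum_pmf_UNIV flip: sum_distrib_right)
    moreover have nonneg: "0 \<le> pmf (K x) s' * (m - h s')" for s' using le[of s'] by simp
    ultimately have "(\<Sum>s'\<in>UNIV. pmf (K x) s' * (m - h s')) = 0"
      by (intro antisym sum_nonneg) auto
    then have "pmf (K x) y * (m - h y) = 0"
      using nonneg by (subst (asm) sum_nonneg_eq_0_iff) auto
    with that show ?thesis by (auto simp: set_pmf_iff)
  qed
  obtain C where C: "recurrent_class K C" "C \<subseteq> {s'. reachable K s s'}"
    using recurrent_class_reachable by blast
  have "h x = m" if "reachable K s x" for x
    using that unfolding reachable_iff_rtranclp by induction (auto simp: m_def[symmetric] step)
  with C le show thesis by (intro that[of C]) force+
qed

text \<open>The maximum principle for \<open>h\<close> and for \<open>- h\<close> puts the maximum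
  and the minimum on recurrent classes. In a unichain these are the same class, so the two values
  agree.\<close>

lemma harmonic_const:
  fixes K :: "'s::finite \<Rightarrow> 's pmf" and h :: "'s \<Rightarrow> real"
  assumes "ergodic_unichain K" and h: "\<And>s. h s = (\<Sum>s'\<in>UNIV. pmf (K s) s' * h s')"
  shows "h s = h s'"
proof -
  obtain C where C: "recurrent_class K C" "\<And>s s'. s \<in> C \<Longrightarrow> h s' \<le> h s"
    using subharmonic_maximum[of h K] h by (metis order_refl)
  have "- h s \<le> (\<Sum>s'\<in>UNIV. pmf (K s) s' * (- h s'))" for s
    using h[of s] by (simp add: sum_negf)
  then obtain C' where C': "recurrent_class K C'" "\<And>s s'. s \<in> C' \<Longrightarrow> - h s' \<le> - h s"
    using subharmonic_maximum[of "\<lambda>s. - h s" K] by metis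
  have "C = C'" using assms(1) C(1) C'(1) unfolding ergodic_unichain_def by blast
  moreover obtain x where "x \<in> C" using C(1) by (auto simp: recurrent_class_def)
  ultimately have "h y = h x" for y using C(2)[of x y] C'(2)[of x y] by force
  then show ?thesis by metis
qed

text \<open>A Fredholm argument: in finite dimension solvability for every \<open>r\<close> follows
  from injectivity, which holds because harmonic functions of a unichain are constant.\<close>

lemma poisson_equation:
  fixes K :: "'s::finite \<Rightarrow> 's pmf" and r :: "'s \<Rightarrow> real"
  assumes K: "ergodic_unichain K"
  obtains g h where "\<And>s. r s = g + h s - (\<Sum>s'\<in>UNIV. pmf (K s) s' * h s')"
proof -
  define P where "P h = (\<chi> s. \<Sum>s'\<in>UNIV. pmf (K s) s' * h $ s')" for h :: "real ^ 's"
  fix s1 :: 's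
  \<comment> \<open>The value at \<open>s1\<close> plays the role of the gain, which makes the linear map \<open>F\<close> injective.\<close>
  define F where "F h = h - P h + (\<chi> s. h $ s1)" for h :: "real ^ 's"
  have "linear F"
    by (rule linearI)
       (auto simp: F_def P_def vec_eq_iff algebra_simps sum.distrib sum_distrib_left)
  have "h = 0" if "F h = 0" for h
  proof -
    have eq: "h $ s - (\<Sum>s'\<in>UNIV. pmf (K s) s' * h $ s') = - (h $ s1)" for s
      using arg_cong[OF that, of "\<lambda>v. v $ s"] by (simp add: F_def P_def)
    \<comment> \<open>At a maximiser \<open>h - P h\<close> is nonnegative and at a minimiser it is
      nonpositive. Since it equals the constant \<open>- (h $ s1)\<close> everywhere, that constant
      is zero and \<open>h\<close> is harmonic.\<close>
    obtain x where "\<And>y. h $ y \<le> h $ x"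
      using finite_attains_max[of "($) h"] by blast
    then have "h $ s1 \<le> 0"
      using eq[of x] sum_pmf_le[of "($) h" "h $ x" "K x"] by simp
    moreover obtain x where "\<And>y. - h $ y \<le> - h $ x"
      using finite_attains_max[of "\<lambda>y. - h $ y"] by blast
    then have "h $ s1 \<ge> 0"
      using eq[of x] sum_pmf_le[of "\<lambda>s. - h $ s" "- h $ x" "K x"] by (simp add: sum_negf)
    ultimately have s1: "h $ s1 = 0" by simp
    have "h $ s = (\<Sum>s'\<in>UNIV. pmf (K s) s' * h $ s')" for s
      using eq[of s] s1 by linarith
    then have "h $ s = h $ s1" for s
      by (rule harmonic_const[OF K, of "($) h"])
    then show ?thesis by (simp add: vec_eq_iff s1)
  qed
  then have "inj F" using \<open>linear F\<close> by (simp add: linear_injective_0)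
  then have "surj F" using \<open>linear F\<close> by (intro linear_injective_imp_surjective) auto
  then obtain h where "F h = (\<chi> s. r s)" by (metis surjD)
  then have Fh: "F h $ s = r s" for s by simp
  have "r s = h $ s1 + h $ s - (\<Sum>s'\<in>UNIV. pmf (K s) s' * h $ s')" for s
    using Fh[of s] by (simp add: F_def P_def)
  then show thesis by (rule that)
qed

text \<open>A Lyapunov function for the substochastic operator \<open>Q\<close> that discounts by
  \<open>c\<close> in state \<open>t\<close>. As \<open>t\<close> is reachable from everywhere, some
  power of \<open>Q\<close> takes the constant 1 strictly below 1; summing the lower powers turns
  this contraction over several steps into a one-step drift.\<close>

lemma geometric_drift:
  fixes K :: "'s::finite \<Rightarrow> 's pmf"
  assumes K: "\<And>s. reachable K s t" and c: "0 \<le> c" "c < 1"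
  obtains u \<kappa> where "\<And>s. 1 \<le> u s" "0 \<le> \<kappa>" "\<kappa> < 1"
    "\<And>s. (if s = t then c else 1) * (\<Sum>s'\<in>UNIV. pmf (K s) s' * u s') \<le> \<kappa> * u s"
proof -
  define Q where "Q f s = (if s = t then c else 1) * (\<Sum>s'\<in>UNIV. pmf (K s) s' * f s')" for f s
  define e where "e n = (Q ^^ n) (\<lambda>_. 1)" for n
  have e0: "e 0 s = 1" and eS: "e (Suc n) = Q (e n)" for s n by (simp_all add: e_def)
  have Q_mono: "Q f s \<le> Q g s" if "\<And>s. f s \<le> g s" for f g s
    unfolding Q_def using c that by (intro mult_left_mono sum_mono) auto
  have e_dec: "e (Suc n) s \<le> e n s" for n s
  proof (induction n arbitrary: s)
    case 0
    show ?case using c by (simp add: eS e0 Q_def sum_pmf_UNIV)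
  next
    case (Suc n)
    then show ?case unfolding eS by (rule Q_mono)
  qed
  have e_anti: "m \<le> n \<Longrightarrow> e n s \<le> e m s" for m n s
    using lift_Suc_antimono_le[of "\<lambda>n. e n s"] e_dec by simp
  have e_nonneg: "0 \<le> e n s" for n s
    by (induction n arbitrary: s) (auto simp: e0 eS Q_def c intro!: sum_nonneg mult_nonneg_nonneg)
  \<comment> \<open>Ignoring the discount during the first \<open>n\<close> steps can only increase
    the value, since \<open>c\<close> is below 1.\<close>
  have nstep: "e (n + j) s \<le> (\<Sum>x\<in>UNIV. pmf (nstep K n s) x * e j x)" for n j s
  proof (induction n arbitrary: j)
    case 0
    then show ?case by (simp add: nstep_def indicator_def if_distrib if_distribR sum.delta cong: if_cong)
  next
    case (Suc n)
    have le: "e (Suc j) x \<le> (\<Sum>y\<in>UNIV. pmf (K x) y * e j y)" for x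
      using c e_nonneg by (auto simp: eS Q_def mult_left_le_one_le sum_nonneg)
    have "e (Suc n + j) s \<le> (\<Sum>x\<in>UNIV. pmf (nstep K n s) x * e (Suc j) x)"
      using Suc.IH[of "Suc j"] by simp
    also have "\<dots> \<le> (\<Sum>x\<in>UNIV. pmf (nstep K n s) x * (\<Sum>y\<in>UNIV. pmf (K x) y * e j y))"
      by (intro sum_mono mult_left_mono le) auto
    also have "\<dots> = (\<Sum>y\<in>UNIV. pmf (nstep K (Suc n) s) y * e j y)"
      by (simp add: nstep_def pmf_bind integral_measure_pmf[of UNIV] sum_distrib_left sum_distrib_right mult.assoc)
         (rule sum.swap)
    finally show ?case .
  qed
  \<comment> \<open>Choose \<open>n\<close> with \<open>t\<close> charged at time \<open>n\<close>.
    The discount applied there, \<open>e 1 t = c\<close>, makes the average strictly smaller than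
    1.\<close>
  have "\<exists>n. e (Suc n) s < 1" for s
  proof -
    obtain n where n: "pmf (nstep K n s) t > 0" using K[of s] by (auto simp: reachable_def)
    have e1: "e 1 x = (if x = t then c else 1)" for x by (simp add: eS[of 0, simplified] Q_def e0 sum_pmf_UNIV)
    have "e (Suc n) s \<le> (\<Sum>x\<in>UNIV. pmf (nstep K n s) x * e 1 x)" using nstep[of n 1] by simp
    also have "\<dots> < (\<Sum>x\<in>UNIV. pmf (nstep K n s) x * 1)"
    proof (rule sum_strict_mono_ex1)
      show "\<exists>x\<in>UNIV. pmf (nstep K n s) x * e 1 x < pmf (nstep K n s) x * 1"
        using n c by (intro bexI[of _ t]) (simp_all only: e1, auto)
    qed (use c in \<open>auto simp only: e1 split: if_splits intro!: mult_left_mono\<close>, auto)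
    also have "\<dots> = 1" by (simp add: sum_pmf_UNIV)
    finally show ?thesis ..
  qed
  then obtain n where n: "\<And>s. e (Suc (n s)) s < 1" by metis
  \<comment> \<open>\<open>e\<close> decreases in its index, so the largest of the finitely many
    indices serves all states at once; \<open>Suc\<close> matches the index
    \<open>Suc (n s)\<close>.\<close>
  define m where "m = Suc (Max (range n))"
  have "e m s < 1" for s
    using n[of s] e_anti[of "Suc (n s)" m s] by (simp add: m_def)
  define b where "b = Max (range (e m))"
  have b: "e m s \<le> b" "b < 1" "0 \<le> b" for s
    using \<open>\<And>s. e m s < 1\<close> e_nonneg[of m] by (auto simp: b_def Max_ge_iff)
  \<comment> \<open>\<open>Q u = u - 1 + Q^m 1\<close>, and \<open>Q^m 1\<close> is bounded away from 1.\<close>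
  define u where "u s = (\<Sum>k<m. e k s)" for s
  have m: "0 < m" by (simp add: m_def)
  have u_ge: "1 \<le> u s" for s
    using sum_mono2[of "{..<m}" "{0}" "\<lambda>k. e k s"] m e_nonneg by (simp add: u_def e0)
  have u_le: "u s \<le> m" for s
    using sum_mono[of "{..<m}" "\<lambda>k. e k s" "\<lambda>_. 1"] e_anti[of 0] by (simp add: u_def e0)
  \<comment> \<open>The sum \<open>u\<close> loses at least \<open>1 - b\<close> under
    \<open>Q\<close>. Since \<open>u\<close> is at most \<open>m\<close>, this is at least the
    fraction \<open>(1 - b) / m\<close> of \<open>u\<close>.\<close>
  define \<kappa> where "\<kappa> = 1 - (1 - b) / m"
  have "Q u s \<le> \<kappa> * u s" for s
  proof -
    have "Q u s = (\<Sum>k<m. e (Suc k) s)"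
      unfolding u_def eS Q_def by (simp add: sum_distrib_left) (intro conjI impI; rule sum.swap)
    also have "\<dots> = u s - 1 + e m s"
      using sum.lessThan_Suc_shift[of "\<lambda>k. e k s" m] by (simp add: u_def e0)
    also have "\<dots> \<le> u s - (1 - b)" using b(1)[of s] by simp
    also have "\<dots> \<le> u s - (1 - b) * (u s / m)"
    proof -
      have "(1 - b) * (u s / m) \<le> (1 - b) * 1"
        using b u_le[of s] m by (intro mult_left_mono) (auto simp: divide_le_eq)
      then show ?thesis by (simp only: mult_1_right diff_left_mono)
    qed
    finally show ?thesis by (simp add: \<kappa>_def algebra_simps)
  qed
  moreover have "0 \<le> \<kappa>" "\<kappa> < 1"
    using b m by (auto simp: \<kappa>_def divide_le_eq)
  ultimately show thesis using u_ge by (intro that[of u \<kappa>]) (auto simp: Q_def)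
qed

section \<open>Rewards and deviations from a stationary policy\<close>

lemma sum_pmf_other: "(\<Sum>a\<in>UNIV. pmf p a * of_bool (a \<noteq> x)) = 1 - pmf p x" for p :: "'a::finite pmf"
proof -
  have "(\<Sum>a\<in>UNIV. pmf p a * of_bool (a \<noteq> x)) = (\<Sum>a\<in>UNIV. pmf p a - (if a = x then pmf p a else 0))"
    by (intro sum.cong) auto
  then show ?thesis by (simp add: sum_subtractf sum_pmf_UNIV)
qed

text \<open>Splitting over the finitely many values of the discrete arguments reduces joint
  measurability to measurability for each fixed state and action.\<close>

lemma measurable_finite_args:
  fixes f :: "'b \<Rightarrow> 's::finite \<Rightarrow> 'a::finite \<Rightarrow> 'c"
  assumes "\<And>s a. (\<lambda>x. f x s a) \<in> measurable N L"
    and "S \<in> measurable N (count_space UNIV)" and "A \<in> measurable N (count_space UNIV)"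
  shows "(\<lambda>x. f x (S x) (A x)) \<in> measurable N L"
  by (rule measurable_compose_countable'[OF measurable_compose_countable'[OF assms(1,3)] assms(2)])
     (auto intro: countable_finite)

context controlled_mdp
begin

lemma measurable_state_action [measurable]:
  fixes f :: "'s \<Rightarrow> 'a \<Rightarrow> 'c::topological_space"
  shows "(\<lambda>\<omega>. f (state \<omega> n) (action \<omega> n)) \<in> borel_measurable traj_space"
  by (rule measurable_finite_args) (auto intro: measurable_traj)

lemma integrable_state_action [simp]:
  fixes f :: "'s \<Rightarrow> 'a \<Rightarrow> real"
  shows "integrable law (\<lambda>\<omega>. f (state \<omega> n) (action \<omega> n))"
proof (rule law.integrable_const_bound)
  have "norm (f s a) \<le> Max (range (\<lambda>(s, a). \<bar>f s a\<bar>))" for s a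
    by (rule Max_ge) auto
  then show "AE \<omega> in law. norm (f (state \<omega> n) (action \<omega> n)) \<le> Max (range (\<lambda>(s, a). \<bar>f s a\<bar>))"
    by simp
qed measurable

lemma prob_law_UNIV: "law.prob UNIV = 1"
  using law.prob_space by simp

lemma emeasure_rdist_UNIV: "emeasure (rdist M \<gamma> s a) UNIV = 1"
  using prob_space.emeasure_space_1[OF prob_space_rdist] by simp

lemma nn_integral_law_step_real:
  fixes f :: "('s, 'a) traj \<Rightarrow> 's \<Rightarrow> 'a \<Rightarrow> real"
  assumes f[measurable]: "\<And>s a. (\<lambda>\<omega>. f \<omega> s a) \<in> borel_measurable (past_space n)"
    and nonneg: "\<And>\<omega> s a. 0 \<le> f \<omega> s a"
    and past: "\<And>\<omega>. f (restrict \<omega> {0..<n}) = f \<omega>"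
  shows "(\<integral>\<^sup>+\<omega>. ennreal (f \<omega> (state \<omega> n) (action \<omega> n)) \<partial>law)
    = (\<integral>\<^sup>+\<omega>. ennreal (\<Sum>s\<in>UNIV. pmf (next_state n \<omega>) s *
        (\<Sum>a\<in>UNIV. pmf (\<mu> n (restrict \<omega> {0..<n}) s) a * f \<omega> s a)) \<partial>law)"
proof -
  let ?F = "\<lambda>\<omega> x. ennreal (f \<omega> (fst x) (fst (snd x)))"
  have "(\<lambda>y. f (fst y) (fst (snd y)) (fst (snd (snd y)))) \<in> borel_measurable (past_space n \<Otimes>\<^sub>M step_space)"
    by (rule measurable_finite_args) measurable
  then have "(\<lambda>(\<omega>, x). ?F \<omega> x) \<in> borel_measurable (past_space n \<Otimes>\<^sub>M step_space)"
    by (simp add: split_beta')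
  note nn_integral_law_step[OF this]
  then have "(\<integral>\<^sup>+\<omega>. ennreal (f \<omega> (state \<omega> n) (action \<omega> n)) \<partial>law)
     = (\<integral>\<^sup>+\<omega>. (\<Sum>s\<in>UNIV. \<Sum>a\<in>UNIV. ennreal (pmf (next_state n \<omega>) s * pmf (\<mu> n (restrict \<omega> {0..<n}) s) a)
          * ennreal (f \<omega> s a)) \<partial>law)"
    by (simp add: past emeasure_rdist_UNIV state_def action_def)
  then show ?thesis
    by (simp add: nonneg sum_nonneg sum_distrib_left mult.assoc flip: sum_ennreal ennreal_mult)
qed

lemma expectation_next_state:
  fixes h :: "'s \<Rightarrow> real"
  shows "(\<integral>\<omega>. h (state \<omega> n) \<partial>law) =
    (if n = 0 then h s0
     else (\<integral>\<omega>. (\<Sum>s\<in>UNIV. pmf (ptrans M \<theta> (state \<omega> (n - 1)) (action \<omega> (n - 1))) s * h s) \<partial>law))"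
proof -
  \<comment> \<open>Adding \<open>b\<close> makes \<open>h\<close> nonnegative, so that the identity
    for nonnegative integrals applies; the shift cancels afterwards.\<close>
  define b where "b = Max (range (\<lambda>s. - h s))"
  have "- h s \<le> b" for s unfolding b_def by (rule Max_ge) auto
  then have b: "0 \<le> h s + b" for s by (metis add_left_mono add.right_inverse)
  let ?g = "\<lambda>\<omega>. \<Sum>s\<in>UNIV. pmf (next_state n \<omega>) s * h s"
  have g: "?g = (if n = 0 then (\<lambda>_. h s0) else
     (\<lambda>\<omega>. \<Sum>s\<in>UNIV. pmf (ptrans M \<theta> (state \<omega> (n - 1)) (action \<omega> (n - 1))) s * h s))"
    by (auto simp: next_state_def indicator_def if_distrib if_distribR sum.delta cong: if_cong)
  have g_int: "integrable law ?g"
    unfolding g using integrable_state_action[of "\<lambda>s a. \<Sum>s'\<in>UNIV. pmf (ptrans M \<theta> s a) s' * h s'"]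
    by auto
  have h_int: "integrable law (\<lambda>\<omega>. h (state \<omega> n))"
    by (rule integrable_state_action)
  have gb: "(\<Sum>s\<in>UNIV. pmf (next_state n \<omega>) s * (h s + b)) = ?g \<omega> + b" for \<omega>
    by (simp add: ring_distribs sum.distrib sum_pmf_UNIV flip: sum_distrib_right)
  have "(\<integral>\<^sup>+\<omega>. ennreal (h (state \<omega> n) + b) \<partial>law) = (\<integral>\<^sup>+\<omega>. ennreal (?g \<omega> + b) \<partial>law)"
    using nn_integral_law_step_real[of "\<lambda>\<omega> s a. h s + b" n] b
    by (simp add: sum_pmf_UNIV gb flip: sum_distrib_right)
  moreover have "0 \<le> ?g \<omega> + b" for \<omega>
    using b by (simp flip: gb add: sum_nonneg)
  ultimately have "(\<integral>\<omega>. h (state \<omega> n) + b \<partial>law) = (\<integral>\<omega>. ?g \<omega> + b \<partial>law)"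
    using b h_int g_int
    by (subst (1 2) integral_eq_nn_integral) (auto simp del: integrable_state_action)
  then have "(\<integral>\<omega>. h (state \<omega> n) \<partial>law) = (\<integral>\<omega>. ?g \<omega> \<partial>law)"
    using h_int g_int by (simp add: prob_law_UNIV)
  then show ?thesis unfolding g by (simp add: prob_law_UNIV split: if_splits)
qed

lemma prob_deviation:
  "ennreal (law.prob {\<omega>. action \<omega> n \<noteq> f (state \<omega> n)})
    = (\<integral>\<^sup>+\<omega>. ennreal (\<Sum>s\<in>UNIV. pmf (next_state n \<omega>) s *
        (1 - pmf (\<mu> n (restrict \<omega> {0..<n}) s) (f s))) \<partial>law)"
proof -
  have [measurable]: "(\<lambda>\<omega>. of_bool (action \<omega> n \<noteq> f (state \<omega> n)) :: real) \<in> borel_measurable traj_space"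
    by (rule measurable_state_action[of "\<lambda>s a. of_bool (a \<noteq> f s)"])
  have "(\<lambda>\<omega>. of_bool (action \<omega> n \<noteq> f (state \<omega> n)) :: real) -` {1} \<inter> space traj_space \<in> sets traj_space"
    by measurable
  then have ms: "{\<omega>. action \<omega> n \<noteq> f (state \<omega> n)} \<in> sets law"
    by (simp add: vimage_def sets_law)
  have "ennreal (law.prob {\<omega>. action \<omega> n \<noteq> f (state \<omega> n)})
      = (\<integral>\<^sup>+\<omega>. ennreal (of_bool (action \<omega> n \<noteq> f (state \<omega> n))) \<partial>law)"
    using ms by (subst law.emeasure_eq_measure[symmetric])
      (auto simp flip: nn_integral_indicator intro!: nn_integral_cong)
  also have "\<dots> = (\<integral>\<^sup>+\<omega>. ennreal (\<Sum>s\<in>UNIV. pmf (next_state n \<omega>) s *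
        (\<Sum>a\<in>UNIV. pmf (\<mu> n (restrict \<omega> {0..<n}) s) a * of_bool (a \<noteq> f s))) \<partial>law)"
    by (rule nn_integral_law_step_real) auto
  finally show ?thesis by (simp only: sum_pmf_other)
qed

lemma expected_reward_near:
  assumes poisson: "\<And>s. rmean M \<theta> s (f s) = g + h s - (\<Sum>s'\<in>UNIV. pmf (induced_chain M \<theta> f s) s' * h s')"
  shows "\<exists>C. \<forall>T. \<bar>expected_reward M \<theta> \<mu> s0 T - real T * g\<bar>
    \<le> C * (1 + (\<Sum>t<T. law.prob {\<omega>. action \<omega> t \<noteq> f (state \<omega> t)}))"
proof -
  define ph where "ph s a = (\<Sum>s'\<in>UNIV. pmf (ptrans M \<theta> s a) s' * h s')" for s a
  \<comment> \<open>The defect of the Poisson equation when \<open>a\<close> is played in place of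
    \<open>f s\<close>. It vanishes at \<open>f s\<close>, so only deviations contribute.\<close>
  define d where "d s a = rmean M \<theta> s a - g - h s + ph s a" for s a
  have d0: "d s (f s) = 0" for s
    using poisson[of s] by (simp add: d_def ph_def induced_chain_def)
  define D where "D = Max (range (\<lambda>(s, a). \<bar>d s a\<bar>))"
  have D: "\<bar>d s a\<bar> \<le> D" for s a unfolding D_def by (rule Max_ge) auto
  then have "0 \<le> D" by (meson abs_ge_zero order_trans)
  define H where "H = Max (range (\<lambda>s. \<bar>h s\<bar>))"
  have H: "\<bar>h s\<bar> \<le> H" for s unfolding H_def by (rule Max_ge) auto
  have hH: "\<bar>\<integral>\<omega>. h (state \<omega> T) \<partial>law\<bar> \<le> H" for T
  proof -
    have "\<bar>\<integral>\<omega>. h (state \<omega> T) \<partial>law\<bar> \<le> (\<integral>\<omega>. \<bar>h (state \<omega> T)\<bar> \<partial>law)"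
      by (rule integral_abs_bound)
    also have "\<dots> \<le> H"
      using integrable_state_action[of "\<lambda>s a. \<bar>h s\<bar>" T] H
      by (intro law.integral_le_const) auto
    finally show ?thesis .
  qed
  have dD: "\<bar>\<integral>\<omega>. d (state \<omega> t) (action \<omega> t) \<partial>law\<bar> \<le> D * law.prob {\<omega>. action \<omega> t \<noteq> f (state \<omega> t)}" for t
  proof -
    have "\<bar>\<integral>\<omega>. d (state \<omega> t) (action \<omega> t) \<partial>law\<bar> \<le> (\<integral>\<omega>. \<bar>d (state \<omega> t) (action \<omega> t)\<bar> \<partial>law)"
      by (rule integral_abs_bound)
    also have "\<dots> \<le> (\<integral>\<omega>. D * of_bool (action \<omega> t \<noteq> f (state \<omega> t)) \<partial>law)"
      using integrable_state_action[of "\<lambda>s a. \<bar>d s a\<bar>" t]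
        integrable_state_action[of "\<lambda>s a. D * of_bool (a \<noteq> f s)" t] D d0 \<open>0 \<le> D\<close>
      by (intro integral_mono) auto
    also have "\<dots> = D * (\<integral>\<omega>. of_bool (action \<omega> t \<noteq> f (state \<omega> t)) \<partial>law)"
      by simp
    also have "(\<lambda>\<omega>. of_bool (action \<omega> t \<noteq> f (state \<omega> t)) :: real) = indicator {\<omega>. action \<omega> t \<noteq> f (state \<omega> t)}"
      by (auto simp: indicator_def)
    finally show ?thesis by simp
  qed
  \<comment> \<open>Summing the defects telescopes \<open>h\<close>: its mean at time
    \<open>Suc T\<close> is the mean of \<open>ph\<close> at time \<open>T\<close>, which leaves
    only the two boundary terms.\<close>
  have eq: "expected_reward M \<theta> \<mu> s0 T - real T * g
      = h s0 - (\<integral>\<omega>. h (state \<omega> T) \<partial>law) + (\<Sum>t<T. \<integral>\<omega>. d (state \<omega> t) (action \<omega> t) \<partial>law)" for T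
  proof (induction T)
    case 0
    show ?case using expectation_next_state[of h 0] by (simp add: expected_reward_def)
  next
    case (Suc T)
    have int: "integrable law (\<lambda>\<omega>. rmean M \<theta> (state \<omega> t) (action \<omega> t))"
        "integrable law (\<lambda>\<omega>. ph (state \<omega> t) (action \<omega> t))"
        "integrable law (\<lambda>\<omega>. h (state \<omega> t))" for t
      by (rule integrable_state_action)+
    have "expected_reward M \<theta> \<mu> s0 (Suc T) = expected_reward M \<theta> \<mu> s0 T + (\<integral>\<omega>. rmean M \<theta> (state \<omega> T) (action \<omega> T) \<partial>law)"
      by (simp add: expected_reward_def)
    moreover have "(\<integral>\<omega>. h (state \<omega> (Suc T)) \<partial>law) = (\<integral>\<omega>. ph (state \<omega> T) (action \<omega> T) \<partial>law)"
      using expectation_next_state[of h "Suc T"] by (simp add: ph_def)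
    moreover have "(\<integral>\<omega>. d (state \<omega> T) (action \<omega> T) \<partial>law) = (\<integral>\<omega>. rmean M \<theta> (state \<omega> T) (action \<omega> T) \<partial>law)
       - g - (\<integral>\<omega>. h (state \<omega> T) \<partial>law) + (\<integral>\<omega>. ph (state \<omega> T) (action \<omega> T) \<partial>law)"
      unfolding d_def using int[of T] by (simp add: prob_law_UNIV)
    ultimately show ?case using Suc.IH by (simp add: algebra_simps)
  qed
  let ?p = "\<lambda>t. law.prob {\<omega>. action \<omega> t \<noteq> f (state \<omega> t)}"
  \<comment> \<open>The boundary terms cost at most \<open>2 * H\<close> together, and a deviation
    costs at most \<open>D\<close>.\<close>
  have "\<bar>expected_reward M \<theta> \<mu> s0 T - real T * g\<bar> \<le> (2 * H + D) * (1 + (\<Sum>t<T. ?p t))" for T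
  proof -
    have p: "0 \<le> (\<Sum>t<T. ?p t)" by (simp add: sum_nonneg)
    have "\<bar>\<Sum>t<T. \<integral>\<omega>. d (state \<omega> t) (action \<omega> t) \<partial>law\<bar> \<le> (\<Sum>t<T. \<bar>\<integral>\<omega>. d (state \<omega> t) (action \<omega> t) \<partial>law\<bar>)"
      by (rule sum_abs)
    also have "\<dots> \<le> D * (\<Sum>t<T. ?p t)"
      unfolding sum_distrib_left by (intro sum_mono dD)
    finally have "\<bar>expected_reward M \<theta> \<mu> s0 T - real T * g\<bar> \<le> 2 * H + D * (\<Sum>t<T. ?p t)"
      using eq[of T] hH[of T] H[of s0] by linarith
    also have "\<dots> \<le> (2 * H + D) * (1 + (\<Sum>t<T. ?p t))"
    proof -
      have "0 \<le> H" using H[of s0] by linarith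
      then have "0 \<le> H * (\<Sum>t<T. ?p t)" using p by simp
      then show ?thesis using \<open>0 \<le> D\<close> by (simp add: algebra_simps)
    qed
    finally show ?thesis .
  qed
  then show ?thesis by blast
qed

end

lemma (in param_mdp) prob_deviation_stationary:
  "measure (traj_law M \<theta> (stationary f) s0) {\<omega>. action \<omega> n \<noteq> f (state \<omega> n)} = 0"
proof -
  interpret controlled_mdp M \<theta> "stationary f" s0
    by unfold_locales (auto simp: admissible_def stationary_def)
  show ?thesis using prob_deviation[of n f] by (simp add: stationary_def)
qed

section \<open>Likelihoods and Hellinger affinities\<close>

text \<open>The convention \<open>y / 0 = 0\<close> makes this true at \<open>x = 0\<close> as well,
  so square roots of density ratios can be integrated against the denominator without a positivity
  assumption.\<close>

lemma mult_sqrt_divide: "0 \<le> x \<Longrightarrow> x * sqrt (y / x) = sqrt (x * y)" for x y :: real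
  by (cases "x = 0") (auto simp: real_sqrt_divide real_sqrt_mult real_div_sqrt field_simps)

text \<open>Integrating \<open>f + g = 2 sqrt (f g) + (sqrt f - sqrt g)^2\<close> shows that twice
  the affinity plus the squared Hellinger distance is 2. Affinity 1 therefore forces the square to
  vanish almost everywhere.\<close>

lemma hellinger_affinity:
  fixes f g :: "'b \<Rightarrow> real"
  assumes [measurable]: "f \<in> borel_measurable N" "g \<in> borel_measurable N"
    and nonneg: "\<And>x. 0 \<le> f x" "\<And>x. 0 \<le> g x"
    and int: "(\<integral>\<^sup>+x. ennreal (f x) \<partial>N) = 1" "(\<integral>\<^sup>+x. ennreal (g x) \<partial>N) = 1"
  shows "(\<integral>\<^sup>+x. ennreal (sqrt (f x * g x)) \<partial>N) \<le> 1"
    and "(\<integral>\<^sup>+x. ennreal (sqrt (f x * g x)) \<partial>N) = 1 \<Longrightarrow> AE x in N. f x = g x"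
proof -
  let ?d = "\<lambda>x. (sqrt (f x) - sqrt (g x))\<^sup>2"
  have eq: "f x + g x = sqrt (f x * g x) + sqrt (f x * g x) + ?d x" for x
    using nonneg[of x] by (simp add: power2_diff real_sqrt_mult)
  let ?I = "\<integral>\<^sup>+x. ennreal (sqrt (f x * g x)) \<partial>N"
  have "2 = (\<integral>\<^sup>+x. ennreal (f x) \<partial>N) + (\<integral>\<^sup>+x. ennreal (g x) \<partial>N)"
    by (simp add: int)
  also have "\<dots> = (\<integral>\<^sup>+x. ennreal (f x + g x) \<partial>N)"
    by (simp add: nonneg nn_integral_add)
  also have "\<dots> = ?I + ?I + (\<integral>\<^sup>+x. ennreal (?d x) \<partial>N)"
  proof -
    have "(\<integral>\<^sup>+x. ennreal (f x + g x) \<partial>N)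
       = (\<integral>\<^sup>+x. ennreal (sqrt (f x * g x)) + ennreal (sqrt (f x * g x)) + ennreal (?d x) \<partial>N)"
      unfolding eq by (intro nn_integral_cong) (simp only: ennreal_plus nonneg add_nonneg_nonneg
        real_sqrt_ge_zero mult_nonneg_nonneg zero_le_power2)
    also have "\<dots> = (\<integral>\<^sup>+x. ennreal (sqrt (f x * g x)) + ennreal (sqrt (f x * g x)) \<partial>N) + (\<integral>\<^sup>+x. ennreal (?d x) \<partial>N)"
      by (rule nn_integral_add) measurable
    also have "(\<integral>\<^sup>+x. ennreal (sqrt (f x * g x)) + ennreal (sqrt (f x * g x)) \<partial>N) = ?I + ?I"
      by (rule nn_integral_add) measurable
    finally show ?thesis .
  qed
  finally have sum: "?I + ?I + (\<integral>\<^sup>+x. ennreal (?d x) \<partial>N) = 2" ..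
  have "?I + ?I \<le> ?I + ?I + (\<integral>\<^sup>+x. ennreal (?d x) \<partial>N)" by (rule add_increasing2) auto
  then have le: "?I + ?I \<le> 2" by (simp only: sum)
  then show "?I \<le> 1"
  proof (cases ?I)
    case (real r)
    with le have "ennreal (r + r) \<le> ennreal 2" by (simp only: ennreal_plus ennreal_numeral)
    then have "r \<le> 1" by (subst (asm) ennreal_le_iff) auto
    then show ?thesis by (simp only: real ennreal_le_1)
  next
    case top
    with le show ?thesis by (simp add: top_unique)
  qed
  assume "?I = 1"
  with sum have "2 + (\<integral>\<^sup>+x. ennreal (?d x) \<partial>N) = 2 + 0" by simp
  then have "(\<integral>\<^sup>+x. ennreal (?d x) \<partial>N) = 0"
    by (subst (asm) ennreal_add_left_cancel) simp
  then have "AE x in N. ennreal (?d x) = 0" by (subst (asm) nn_integral_0_iff_AE) auto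
  then show "AE x in N. f x = g x" using nonneg by (auto elim!: eventually_mono)
qed

text \<open>The derivative of \<open>N\<close> with respect to itself is 1 almost everywhere, so the
  log-likelihood ratio vanishes almost everywhere. In particular it is integrable, which selects the
  finite branch of \<open>KL\<close>.\<close>

lemma KL_self:
  assumes "prob_space N"
  shows "KL N N = 0"
proof -
  interpret prob_space N by fact
  have "AE x in N. 1 = RN_deriv N N x"
    by (rule RN_deriv_unique) (simp_all add: density_1)
  then have ae: "AE x in N. entropy_density (exp 1) N N x = 0"
    by (auto simp: entropy_density_def elim!: eventually_mono)
  then have "integrable N (entropy_density (exp 1) N N)"
    by (subst integrable_cong_AE[where g="\<lambda>_. 0"]) auto
  then show ?thesis by (simp add: KL_def KL_same_eq_0)
qed

section \<open>Affinities of rewards and transitions\<close>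

context param_mdp
begin

text \<open>The Bhattacharyya coefficient of the reward densities. Reward and next state are
  independent given state and action, so its product with \<open>state_affinity\<close> is the
  coefficient of the outcome laws.\<close>

definition reward_affinity :: "'p \<Rightarrow> 'p \<Rightarrow> 's \<Rightarrow> 'a \<Rightarrow> real" where
  "reward_affinity \<theta> \<gamma> s a = enn2real (\<integral>\<^sup>+x. ennreal (sqrt (rdens M \<theta> s a x * rdens M \<gamma> s a x)) \<partial>rref M)"

definition state_affinity :: "'p \<Rightarrow> 'p \<Rightarrow> 's \<Rightarrow> 'a \<Rightarrow> real" where
  "state_affinity \<theta> \<gamma> s a = (\<Sum>s'\<in>UNIV. sqrt (pmf (ptrans M \<theta> s a) s' * pmf (ptrans M \<gamma> s a) s'))"

lemma nn_integral_rdens: "(\<integral>\<^sup>+x. ennreal (rdens M \<theta> s a x) \<partial>rref M) = 1"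
  using prob_space.emeasure_space_1[OF prob_space_rdist[of \<theta> s a]] rdens_measurable[of \<theta> s a]
  by (simp add: rdist_def emeasure_density cong: nn_integral_cong)

lemma
  shows reward_affinity_le_1: "reward_affinity \<theta> \<gamma> s a \<le> 1"
    and ennreal_reward_affinity: "ennreal (reward_affinity \<theta> \<gamma> s a)
      = (\<integral>\<^sup>+x. ennreal (sqrt (rdens M \<theta> s a x * rdens M \<gamma> s a x)) \<partial>rref M)"
    and reward_affinity_eq_1: "reward_affinity \<theta> \<gamma> s a = 1 \<Longrightarrow> rdist M \<theta> s a = rdist M \<gamma> s a"
proof -
  let ?I = "\<integral>\<^sup>+x. ennreal (sqrt (rdens M \<theta> s a x * rdens M \<gamma> s a x)) \<partial>rref M"
  note H = hellinger_affinity[OF rdens_measurable rdens_measurable rdens_nonneg rdens_nonneg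
      nn_integral_rdens nn_integral_rdens, of \<theta> s a \<gamma> s a]
  show eq: "ennreal (reward_affinity \<theta> \<gamma> s a) = ?I"
    unfolding reward_affinity_def using H(1) by (intro ennreal_enn2real) (auto simp: less_top[symmetric] top_unique)
  show "reward_affinity \<theta> \<gamma> s a \<le> 1"
    using H(1) by (simp flip: eq)
  assume "reward_affinity \<theta> \<gamma> s a = 1"
  with H(2) have "AE x in rref M. rdens M \<theta> s a x = rdens M \<gamma> s a x" by (simp flip: eq)
  then show "rdist M \<theta> s a = rdist M \<gamma> s a"
    unfolding rdist_def using rdens_measurable by (intro density_cong) auto
qed

lemma
  shows state_affinity_le_1: "state_affinity \<theta> \<gamma> s a \<le> 1"
    and state_affinity_eq_1: "state_affinity \<theta> \<gamma> s a = 1 \<Longrightarrow> ptrans M \<theta> s a = ptrans M \<gamma> s a"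
proof -
  have int: "(\<integral>\<^sup>+x. ennreal (pmf p x) \<partial>count_space UNIV) = 1" for p :: "'s pmf"
    by (simp add: nn_integral_count_space_finite sum_pmf_UNIV)
  have eq: "(\<integral>\<^sup>+x. ennreal (sqrt (pmf (ptrans M \<theta> s a) x * pmf (ptrans M \<gamma> s a) x)) \<partial>count_space UNIV)
    = ennreal (state_affinity \<theta> \<gamma> s a)"
    by (simp add: nn_integral_count_space_finite state_affinity_def)
  note H = hellinger_affinity[OF _ _ pmf_nonneg pmf_nonneg int int, of "ptrans M \<theta> s a" "ptrans M \<gamma> s a", unfolded eq]
  show "state_affinity \<theta> \<gamma> s a \<le> 1" using H(1) by simp
  assume "state_affinity \<theta> \<gamma> s a = 1"
  with H(2) show "ptrans M \<theta> s a = ptrans M \<gamma> s a"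
    by (simp add: AE_count_space pmf_eqI)
qed

lemma reward_affinity_nonneg: "0 \<le> reward_affinity \<theta> \<gamma> s a"
  by (simp add: reward_affinity_def)

lemma state_affinity_nonneg: "0 \<le> state_affinity \<theta> \<gamma> s a"
  by (auto simp: state_affinity_def intro!: sum_nonneg)

lemma prob_space_outcome: "prob_space (outcome M \<theta> s a)"
proof -
  interpret R: prob_space "rdist M \<theta> s a" by (rule prob_space_rdist)
  interpret pair_prob_space "rdist M \<theta> s a" "measure_pmf (ptrans M \<theta> s a)" ..
  show ?thesis unfolding outcome_def by unfold_locales
qed

text \<open>Both factors lie between 0 and 1, so a product of at least 1 makes both equal to 1. Then
  reward and transition laws coincide under the two parameters and the divergence is zero, against
  informativeness.\<close>

lemma informative_affinity:
  assumes "informative M s a" "\<theta> \<noteq> \<gamma>"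
  shows "reward_affinity \<theta> \<gamma> s a * state_affinity \<theta> \<gamma> s a < 1"
proof (rule ccontr)
  assume "\<not> ?thesis"
  then have le: "1 \<le> reward_affinity \<theta> \<gamma> s a * state_affinity \<theta> \<gamma> s a" by simp
  then have "1 \<le> reward_affinity \<theta> \<gamma> s a" "1 \<le> state_affinity \<theta> \<gamma> s a"
    using mult_left_le[OF state_affinity_le_1 reward_affinity_nonneg, of \<theta> \<gamma> s a \<theta> \<gamma> s a]
      mult_left_le_one_le[OF state_affinity_nonneg reward_affinity_nonneg reward_affinity_le_1, of \<theta> \<gamma> s a \<theta> \<gamma> s a]
    by linarith+
  then have "outcome M \<theta> s a = outcome M \<gamma> s a"
    using reward_affinity_eq_1 state_affinity_eq_1 reward_affinity_le_1 state_affinity_le_1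
    by (metis antisym outcome_def)
  then have "KL (outcome M \<theta> s a) (outcome M \<gamma> s a) = 0"
    by (simp add: KL_self prob_space_outcome)
  with assms show False unfolding informative_def by (metis less_irrefl)
qed

lemma nn_integral_reward_ratio:
  "(\<integral>\<^sup>+r. ennreal (sqrt (rdens M \<gamma> s a r / rdens M \<theta> s a r)) \<partial>rdist M \<theta> s a) = ennreal (reward_affinity \<theta> \<gamma> s a)"
proof -
  note [measurable] = rdens_measurable
  show ?thesis
    unfolding rdist_def ennreal_reward_affinity
    by (subst nn_integral_density) (auto simp: rdens_nonneg mult_sqrt_divide simp flip: ennreal_mult)
qed

section \<open>Recursions for likelihoods and visit counts\<close>

lemma likelihood_0 [simp]: "likelihood M \<gamma> 0 \<omega> s = 1"
  by (simp add: likelihood_def)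

text \<open>The current state enters a likelihood only as the target of the last transition. In the
  longer history that target is recorded in the trajectory, hence \<open>state \<omega> n\<close> in
  the shorter likelihood.\<close>

lemma likelihood_Suc:
  "likelihood M \<gamma> (Suc n) \<omega> s = likelihood M \<gamma> n \<omega> (state \<omega> n)
     * (rdens M \<gamma> (state \<omega> n) (action \<omega> n) (reward \<omega> n) * pmf (ptrans M \<gamma> (state \<omega> n) (action \<omega> n)) s)"
proof -
  have "(if Suc i < n then state \<omega> (Suc i) else state \<omega> n) = state \<omega> (Suc i)" if "i < n" for i
    using that by (cases "Suc i < n") (auto dest: not_less_less_Suc_eq simp: Suc_lessI less_Suc_eq)
  then show ?thesis by (simp add: likelihood_def)
qed

lemma likelihood_nonneg: "0 \<le> likelihood M \<gamma> n \<omega> s"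
  by (auto simp: likelihood_def rdens_nonneg intro!: prod_nonneg)

lemma likelihood_restrict [simp]: "likelihood M \<gamma> n (restrict \<omega> {0..<n}) s = likelihood M \<gamma> n \<omega> s"
  by (auto simp: likelihood_def state_def action_def reward_def intro!: prod.cong)

lemma measurable_likelihood [measurable]:
  "(\<lambda>\<omega>. likelihood M \<gamma> n \<omega> s) \<in> borel_measurable (past_space n)"
  unfolding likelihood_def
proof (intro borel_measurable_prod borel_measurable_times)
  fix i assume "i \<in> {..<n}"
  then have i: "i < n" by simp
  have "rdens M \<gamma> s a \<in> borel_measurable borel" for s a
    using rdens_measurable[of \<gamma> s a] by (simp add: measurable_cong_sets[OF sets_rref refl])
  from measurable_compose[OF measurable_past(3)[OF i] this]
  show "(\<lambda>\<omega>. rdens M \<gamma> (state \<omega> i) (action \<omega> i) (reward \<omega> i)) \<in> borel_measurable (past_space n)"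
    by (rule measurable_finite_args) (auto intro: i measurable_past)
  have "(\<lambda>\<omega>. pmf p (state \<omega> (Suc i))) \<in> borel_measurable (past_space n)" if "Suc i < n" for p
    by (rule measurable_compose[OF measurable_past(1)[OF that]]) simp
  then have "(\<lambda>\<omega>. pmf p (if Suc i < n then state \<omega> (Suc i) else s)) \<in> borel_measurable (past_space n)" for p
    by (cases "Suc i < n") auto
  then show "(\<lambda>\<omega>. pmf (ptrans M \<gamma> (state \<omega> i) (action \<omega> i)) (if Suc i < n then state \<omega> (Suc i) else s)) \<in> borel_measurable (past_space n)"
    by (rule measurable_finite_args[where f="\<lambda>\<omega> x y. pmf (ptrans M \<gamma> x y) (if Suc i < n then state \<omega> (Suc i) else s)"]) (auto intro: i measurable_past)
qed

end

lemma visits_0 [simp]: "visits \<omega> 0 t = 0"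
  by (simp add: visits_def)

lemma visits_Suc: "visits \<omega> (Suc n) t = visits \<omega> n t + of_bool (state \<omega> n = t)"
proof -
  have "{i. i < Suc n \<and> state \<omega> i = t} = {i. i < n \<and> state \<omega> i = t} \<union> (if state \<omega> n = t then {n} else {})"
    by (auto simp: less_Suc_eq)
  then show ?thesis by (auto simp: visits_def)
qed

lemma visits_restrict [simp]: "visits (restrict \<omega> {0..<n}) n t = visits \<omega> n t"
  by (auto simp: visits_def state_def intro!: arg_cong[where f=card])

lemma measurable_visits:
  assumes "\<And>i. i < n \<Longrightarrow> (\<lambda>\<omega>. state \<omega> i) \<in> measurable N (count_space UNIV)"
  shows "(\<lambda>\<omega>. visits \<omega> n t) \<in> measurable N (count_space UNIV)"
  using assms
proof (induction n)
  case (Suc n)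
  have "(\<lambda>\<omega>. of_bool (state \<omega> n = t) :: nat) \<in> measurable N (count_space UNIV)"
    by (rule measurable_compose[OF Suc.prems]) auto
  with Suc show ?case unfolding visits_Suc by measurable
qed simp

lemma measurable_visits_past [measurable]: "(\<lambda>\<omega>. visits \<omega> n t) \<in> measurable (past_space n) (count_space UNIV)"
  by (rule measurable_visits) (rule measurable_past)

lemma measurable_visits_traj [measurable]: "(\<lambda>\<omega>. visits \<omega> n t) \<in> measurable traj_space (count_space UNIV)"
  by (rule measurable_visits) (rule measurable_traj)

section \<open>Likelihood ratios and visit counts along trajectories\<close>

lemma (in param_mdp) rdens_borel [measurable]: "rdens M \<gamma> s a \<in> borel_measurable borel"
  using rdens_measurable[of \<gamma> s a] by (simp add: measurable_cong_sets[OF sets_rref refl])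

lemma measurable_traj_past:
  assumes f: "f \<in> measurable (past_space n) L" and past: "\<And>\<omega>. f (restrict \<omega> {0..<n}) = f \<omega>"
  shows "f \<in> measurable traj_space L"
proof -
  have "(\<lambda>\<omega>. restrict \<omega> {0..<n}) \<in> measurable traj_space (past_space n)"
    unfolding traj_space_def past_space_def by (rule measurable_restrict_subset) simp
  from measurable_compose[OF this f] show ?thesis by (simp only: past)
qed

context controlled_mdp
begin

lemma emeasure_law_UNIV [simp]: "emeasure law UNIV = 1"
  using law.emeasure_space_1 by simp

lemma next_state_0 [simp]: "next_state 0 \<omega> = return_pmf s0"
  and next_state_Suc [simp]: "next_state (Suc n) \<omega> = ptrans M \<theta> (state \<omega> n) (action \<omega> n)"
  by (simp_all add: next_state_def)

lemma sum_return_pmf: "(\<Sum>s\<in>UNIV. pmf (return_pmf s0) s * f s) = f s0" for f :: "'s \<Rightarrow> real"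
  by (simp add: indicator_def if_distrib if_distribR sum.delta cong: if_cong)

text \<open>The common induction step of the three estimates below: a bound on the reward integral
  is averaged over action and state. It is demanded only for actions in the support of the policy,
  which is how the restriction to candidate actions enters.\<close>

lemma nn_integral_law_step_le:
  fixes F :: "('s, 'a) traj \<Rightarrow> 's \<Rightarrow> 'a \<Rightarrow> real \<Rightarrow> real"
  assumes F: "\<And>s a. (\<lambda>(\<omega>, r). F \<omega> s a r) \<in> borel_measurable (past_space n \<Otimes>\<^sub>M borel)"
    and past: "\<And>\<omega>. F (restrict \<omega> {0..<n}) = F \<omega>"
    and le: "\<And>\<omega> s a. a \<in> set_pmf (\<mu> n (restrict \<omega> {0..<n}) s) \<Longrightarrow>
      (\<integral>\<^sup>+r. ennreal (F \<omega> s a r) \<partial>rdist M \<theta> s a) \<le> ennreal (B \<omega> s)"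
    and B: "\<And>\<omega> s. 0 \<le> B \<omega> s"
  shows "(\<integral>\<^sup>+\<omega>. ennreal (F \<omega> (state \<omega> n) (action \<omega> n) (reward \<omega> n)) \<partial>law)
    \<le> (\<integral>\<^sup>+\<omega>. ennreal (\<Sum>s\<in>UNIV. pmf (next_state n \<omega>) s * B \<omega> s) \<partial>law)"
proof -
  let ?F = "\<lambda>\<omega> x. ennreal (F \<omega> (fst x) (fst (snd x)) (snd (snd x)))"
  have "(\<lambda>y. (fst y, snd (snd (snd y)))) \<in> measurable (past_space n \<Otimes>\<^sub>M step_space) (past_space n \<Otimes>\<^sub>M borel)"
    by measurable
  from measurable_compose[OF this F]
  have "(\<lambda>y. F (fst y) s a (snd (snd (snd y)))) \<in> borel_measurable (past_space n \<Otimes>\<^sub>M step_space)" for s a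
    by simp
  then have "(\<lambda>y. F (fst y) (fst (snd y)) (fst (snd (snd y))) (snd (snd (snd y)))) \<in> borel_measurable (past_space n \<Otimes>\<^sub>M step_space)"
    by (rule measurable_finite_args) measurable
  then have "(\<lambda>(\<omega>, x). ?F \<omega> x) \<in> borel_measurable (past_space n \<Otimes>\<^sub>M step_space)"
    by (simp add: split_beta')
  note nn_integral_law_step[OF this]
  then have "(\<integral>\<^sup>+\<omega>. ennreal (F \<omega> (state \<omega> n) (action \<omega> n) (reward \<omega> n)) \<partial>law)
     = (\<integral>\<^sup>+\<omega>. (\<Sum>s\<in>UNIV. \<Sum>a\<in>UNIV. ennreal (pmf (next_state n \<omega>) s * pmf (\<mu> n (restrict \<omega> {0..<n}) s) a)
          * (\<integral>\<^sup>+r. ennreal (F \<omega> s a r) \<partial>rdist M \<theta> s a)) \<partial>law)"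
    by (simp add: past state_def action_def reward_def)
  also have "\<dots> \<le> (\<integral>\<^sup>+\<omega>. (\<Sum>s\<in>UNIV. \<Sum>a\<in>UNIV. ennreal (pmf (next_state n \<omega>) s * pmf (\<mu> n (restrict \<omega> {0..<n}) s) a)
          * ennreal (B \<omega> s)) \<partial>law)"
  proof (intro nn_integral_mono sum_mono)
    fix \<omega> s a
    show "ennreal (pmf (next_state n \<omega>) s * pmf (\<mu> n (restrict \<omega> {0..<n}) s) a)
          * (\<integral>\<^sup>+r. ennreal (F \<omega> s a r) \<partial>rdist M \<theta> s a)
      \<le> ennreal (pmf (next_state n \<omega>) s * pmf (\<mu> n (restrict \<omega> {0..<n}) s) a) * ennreal (B \<omega> s)"
      using le[of a \<omega> s]
      by (cases "a \<in> set_pmf (\<mu> n (restrict \<omega> {0..<n}) s)") (auto simp: set_pmf_iff intro!: mult_left_mono)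
  qed
  also have "\<dots> = (\<integral>\<^sup>+\<omega>. ennreal (\<Sum>s\<in>UNIV. pmf (next_state n \<omega>) s * (\<Sum>a\<in>UNIV. pmf (\<mu> n (restrict \<omega> {0..<n}) s) a) * B \<omega> s) \<partial>law)"
    by (simp add: B sum_nonneg sum_distrib_left sum_distrib_right flip: sum_ennreal ennreal_mult)
  finally show ?thesis by (simp add: sum_pmf_UNIV)
qed

text \<open>With the square root, one-step means under \<theta> become Hellinger affinities, which
  can be strictly below 1; the mean of the plain ratio would not decay.\<close>

definition sqrt_ratio :: "'p \<Rightarrow> nat \<Rightarrow> ('s, 'a) traj \<Rightarrow> 's \<Rightarrow> real" where
  "sqrt_ratio \<gamma> n \<omega> s = sqrt (likelihood M \<gamma> n \<omega> s / likelihood M \<theta> n \<omega> s)"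

lemma sqrt_ratio_nonneg: "0 \<le> sqrt_ratio \<gamma> n \<omega> s"
  by (simp add: sqrt_ratio_def likelihood_nonneg)

text \<open>
  Averaging over the next state turns the latest transition factor into a state affinity at the same
  state-action pair as the latest reward affinity; only the product of the two is known to be at most \<open>c\<close>.
\<close>

lemma hellinger_supermartingale:
  assumes c: "0 < c" "c \<le> 1"
    and aff: "\<And>n \<omega> a. a \<in> set_pmf (\<mu> n (restrict \<omega> {0..<n}) t) \<Longrightarrow>
      reward_affinity \<theta> \<gamma> t a * state_affinity \<theta> \<gamma> t a \<le> c"
  shows "(\<integral>\<^sup>+\<omega>. ennreal ((\<Sum>s\<in>UNIV. pmf (next_state n \<omega>) s * sqrt_ratio \<gamma> n \<omega> s) / c ^ visits \<omega> n t) \<partial>law) \<le> 1"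
proof (induction n)
  case 0
  show ?case by (simp add: sum_return_pmf sqrt_ratio_def sum_pmf_UNIV del: pmf_return)
next
  case (Suc n)
  \<comment> \<open>What is left once the state at time \<open>Suc n\<close> has been averaged out,
    as a function of the past and the state, action and reward of time \<open>n\<close>.\<close>
  define F where "F \<omega> s a r = sqrt_ratio \<gamma> n \<omega> s * sqrt (rdens M \<gamma> s a r / rdens M \<theta> s a r)
     * state_affinity \<theta> \<gamma> s a / (c ^ visits \<omega> n t * (if s = t then c else 1))" for \<omega> s a r
  have "(\<integral>\<^sup>+\<omega>. ennreal ((\<Sum>s\<in>UNIV. pmf (next_state (Suc n) \<omega>) s * sqrt_ratio \<gamma> (Suc n) \<omega> s) / c ^ visits \<omega> (Suc n) t) \<partial>law)
      = (\<integral>\<^sup>+\<omega>. ennreal (F \<omega> (state \<omega> n) (action \<omega> n) (reward \<omega> n)) \<partial>law)"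
  proof (intro nn_integral_cong arg_cong[where f=ennreal])
    fix \<omega>
    have eq: "pmf (ptrans M \<theta> (state \<omega> n) (action \<omega> n)) s * sqrt_ratio \<gamma> (Suc n) \<omega> s
      = sqrt_ratio \<gamma> n \<omega> (state \<omega> n)
        * sqrt (rdens M \<gamma> (state \<omega> n) (action \<omega> n) (reward \<omega> n) / rdens M \<theta> (state \<omega> n) (action \<omega> n) (reward \<omega> n))
        * sqrt (pmf (ptrans M \<theta> (state \<omega> n) (action \<omega> n)) s * pmf (ptrans M \<gamma> (state \<omega> n) (action \<omega> n)) s)" for s
      by (subst mult_sqrt_divide[symmetric])
         (simp_all add: sqrt_ratio_def likelihood_Suc real_sqrt_mult real_sqrt_divide mult_ac)
    show "(\<Sum>s\<in>UNIV. pmf (next_state (Suc n) \<omega>) s * sqrt_ratio \<gamma> (Suc n) \<omega> s) / c ^ visits \<omega> (Suc n) t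
      = F \<omega> (state \<omega> n) (action \<omega> n) (reward \<omega> n)"
      by (simp add: eq F_def visits_Suc state_affinity_def flip: sum_distrib_left)
  qed
  also have "\<dots> \<le> (\<integral>\<^sup>+\<omega>. ennreal (\<Sum>s\<in>UNIV. pmf (next_state n \<omega>) s * (sqrt_ratio \<gamma> n \<omega> s / c ^ visits \<omega> n t)) \<partial>law)"
  proof (rule nn_integral_law_step_le)
    fix s a
    show "(\<lambda>(\<omega>, r). F \<omega> s a r) \<in> borel_measurable (past_space n \<Otimes>\<^sub>M borel)"
      unfolding F_def sqrt_ratio_def by measurable
  next
    fix \<omega> :: "('s, 'a) traj" and s a assume a: "a \<in> set_pmf (\<mu> n (restrict \<omega> {0..<n}) s)"
    define k where "k = sqrt_ratio \<gamma> n \<omega> s / c ^ visits \<omega> n t"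
    have k: "0 \<le> k" using c by (simp add: k_def sqrt_ratio_nonneg)
    \<comment> \<open>At \<open>t\<close> the affinity bound \<open>c\<close> pays for the
      additional visit in the exponent; elsewhere the count is unchanged and affinities are at most
      1.\<close>
    define w where "w = (if s = t then c else 1)"
    have w: "0 < w" using c by (simp add: w_def)
    have "reward_affinity \<theta> \<gamma> s a * state_affinity \<theta> \<gamma> s a \<le> w"
    proof (cases "s = t")
      case True
      then show ?thesis using aff[of a n \<omega>] a by (simp add: w_def)
    next
      case False
      then show ?thesis
        by (simp add: w_def mult_le_one reward_affinity_le_1 state_affinity_le_1 state_affinity_nonneg)
    qed
    then have le: "k * state_affinity \<theta> \<gamma> s a / w * reward_affinity \<theta> \<gamma> s a \<le> k"
      using k w mult_left_mono[of "reward_affinity \<theta> \<gamma> s a * state_affinity \<theta> \<gamma> s a" w k]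
      by (simp add: field_simps)
    have F_eq: "F \<omega> s a r = (k * state_affinity \<theta> \<gamma> s a / w) * sqrt (rdens M \<gamma> s a r / rdens M \<theta> s a r)" for r
      by (simp add: F_def k_def w_def mult_ac)
    have "(\<integral>\<^sup>+r. ennreal (F \<omega> s a r) \<partial>rdist M \<theta> s a)
      = (\<integral>\<^sup>+r. ennreal (k * state_affinity \<theta> \<gamma> s a / w) * ennreal (sqrt (rdens M \<gamma> s a r / rdens M \<theta> s a r)) \<partial>rdist M \<theta> s a)"
      unfolding F_eq using k w
      by (intro nn_integral_cong ennreal_mult) (auto simp: state_affinity_nonneg rdens_nonneg)
    also have "\<dots> = ennreal (k * state_affinity \<theta> \<gamma> s a / w * reward_affinity \<theta> \<gamma> s a)"
      using k w by (subst nn_integral_cmult)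
         (auto simp: nn_integral_reward_ratio state_affinity_nonneg reward_affinity_nonneg simp flip: ennreal_mult)
    also have "\<dots> \<le> ennreal k" using le by (rule ennreal_leI)
    finally show "(\<integral>\<^sup>+r. ennreal (F \<omega> s a r) \<partial>rdist M \<theta> s a) \<le> ennreal (sqrt_ratio \<gamma> n \<omega> s / c ^ visits \<omega> n t)"
      unfolding k_def .
  qed (simp_all only: F_def sqrt_ratio_def likelihood_restrict visits_restrict,
      use c in \<open>auto simp: likelihood_nonneg\<close>)
  also have "\<dots> \<le> 1" using Suc.IH by (simp add: sum_divide_distrib)
  finally show ?case .
qed

text \<open>A draw from a density almost surely lands where the density is positive, and a drawn
  state has positive probability. The true likelihood, by which the posterior bound divides, is thus
  almost surely nonzero.\<close>

lemma nn_integral_likelihood_zero: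
  "(\<integral>\<^sup>+\<omega>. ennreal (\<Sum>s\<in>UNIV. pmf (next_state n \<omega>) s * (if likelihood M \<theta> n \<omega> s = 0 then 1 else 0)) \<partial>law) = 0"
proof (induction n)
  case 0
  show ?case by (simp add: sum_return_pmf del: pmf_return)
next
  case (Suc n)
  \<comment> \<open>A union bound over the old likelihood and the new reward density. If instead the
    transition probability is the zero factor, its weight in the sum vanishes as well.\<close>
  define F where "F \<omega> s a r = (if likelihood M \<theta> n \<omega> s = 0 then 1 else 0) + (if rdens M \<theta> s a r = 0 then 1 else 0 :: real)" for \<omega> s a r
  have "(\<integral>\<^sup>+\<omega>. ennreal (\<Sum>s\<in>UNIV. pmf (next_state (Suc n) \<omega>) s * (if likelihood M \<theta> (Suc n) \<omega> s = 0 then 1 else 0)) \<partial>law)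
    \<le> (\<integral>\<^sup>+\<omega>. ennreal (F \<omega> (state \<omega> n) (action \<omega> n) (reward \<omega> n)) \<partial>law)"
  proof (intro nn_integral_mono ennreal_leI)
    fix \<omega>
    let ?x = "F \<omega> (state \<omega> n) (action \<omega> n) (reward \<omega> n)"
    have "(\<Sum>s\<in>UNIV. pmf (next_state (Suc n) \<omega>) s * (if likelihood M \<theta> (Suc n) \<omega> s = 0 then 1 else 0))
       \<le> (\<Sum>s\<in>UNIV. pmf (next_state (Suc n) \<omega>) s * ?x)"
      by (intro sum_mono) (auto simp: F_def likelihood_Suc)
    then show "(\<Sum>s\<in>UNIV. pmf (next_state (Suc n) \<omega>) s * (if likelihood M \<theta> (Suc n) \<omega> s = 0 then 1 else 0)) \<le> ?x"
      by (simp add: sum_pmf_UNIV flip: sum_distrib_right)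
  qed
  also have "\<dots> \<le> (\<integral>\<^sup>+\<omega>. ennreal (\<Sum>s\<in>UNIV. pmf (next_state n \<omega>) s * (if likelihood M \<theta> n \<omega> s = 0 then 1 else 0)) \<partial>law)"
  proof (rule nn_integral_law_step_le)
    fix s a
    show "(\<lambda>(\<omega>, r). F \<omega> s a r) \<in> borel_measurable (past_space n \<Otimes>\<^sub>M borel)"
      unfolding F_def by measurable
  next
    fix \<omega> :: "('s, 'a) traj" and s a
    have "(\<integral>\<^sup>+r. ennreal (if rdens M \<theta> s a r = 0 then 1 else 0) \<partial>rdist M \<theta> s a) = 0"
      unfolding rdist_def using rdens_measurable[of \<theta> s a, measurable]
      by (subst nn_integral_density) (auto simp flip: ennreal_mult simp: rdens_nonneg intro!: nn_integral_zero')
    then show "(\<integral>\<^sup>+r. ennreal (F \<omega> s a r) \<partial>rdist M \<theta> s a) \<le> ennreal (if likelihood M \<theta> n \<omega> s = 0 then 1 else 0)"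
      unfolding F_def by (subst ennreal_plus) (auto simp: nn_integral_add emeasure_rdist_UNIV)
  qed (simp_all only: F_def likelihood_restrict, auto)
  finally show ?case using Suc.IH by simp
qed

end

text \<open>By the drift inequality, the mean of the discount \<open>c ^ visits\<close> times the
  Lyapunov function at the next state shrinks by the factor \<kappa> in each step.\<close>

lemma (in param_mdp) visits_stationary_bound:
  assumes c: "0 \<le> c" "c < 1" and bar: "\<And>s. reachable (induced_chain M \<theta> f) s t"
  shows "\<exists>C \<kappa>. 0 \<le> \<kappa> \<and> \<kappa> < 1 \<and> 0 \<le> C \<and>
    (\<forall>n. (\<integral>\<^sup>+\<omega>. ennreal (c ^ visits \<omega> n t) \<partial>traj_law M \<theta> (stationary f) s0) \<le> ennreal (C * \<kappa> ^ n))"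
proof -
  interpret controlled_mdp M \<theta> "stationary f" s0
    by unfold_locales (auto simp: admissible_def stationary_def)
  from geometric_drift[OF bar c] obtain u \<kappa> where u: "\<And>s. 1 \<le> u s" and \<kappa>: "0 \<le> \<kappa>" "\<kappa> < 1" and
    drift: "\<And>s. (if s = t then c else 1) * (\<Sum>s'\<in>UNIV. pmf (induced_chain M \<theta> f s) s' * u s') \<le> \<kappa> * u s" by metis
  have u0: "0 \<le> u s" for s using u[of s] by linarith
  have V: "(\<integral>\<^sup>+\<omega>. ennreal (\<Sum>s\<in>UNIV. pmf (next_state n \<omega>) s * (c ^ visits \<omega> n t * u s)) \<partial>law) \<le> ennreal (u s0 * \<kappa> ^ n)" for n
  proof (induction n)
    case 0
    show ?case by (simp add: sum_return_pmf del: pmf_return)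
  next
    case (Suc n)
    define F where "F \<omega> s a r = c ^ visits \<omega> n t * (if s = t then c else 1) * (\<Sum>s'\<in>UNIV. pmf (ptrans M \<theta> s a) s' * u s')"
      for \<omega> :: "('s, 'a) traj" and s a and r :: real
    have "(\<integral>\<^sup>+\<omega>. ennreal (\<Sum>s\<in>UNIV. pmf (next_state (Suc n) \<omega>) s * (c ^ visits \<omega> (Suc n) t * u s)) \<partial>law)
      = (\<integral>\<^sup>+\<omega>. ennreal (F \<omega> (state \<omega> n) (action \<omega> n) (reward \<omega> n)) \<partial>law)"
      by (intro nn_integral_cong arg_cong[where f=ennreal])
         (auto simp: F_def visits_Suc sum_distrib_left mult_ac intro!: sum.cong)
    also have "\<dots> \<le> (\<integral>\<^sup>+\<omega>. ennreal (\<Sum>s\<in>UNIV. pmf (next_state n \<omega>) s * (\<kappa> * (c ^ visits \<omega> n t * u s))) \<partial>law)"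
    proof (rule nn_integral_law_step_le)
      fix s a
      show "(\<lambda>(\<omega>, r). F \<omega> s a r) \<in> borel_measurable (past_space n \<Otimes>\<^sub>M borel)"
        unfolding F_def by measurable
    next
      fix \<omega> s a
      assume "a \<in> set_pmf (stationary f n (restrict \<omega> {0..<n}) s)"
      then have "a = f s" by (simp add: stationary_def)
      have "F \<omega> s (f s) r \<le> \<kappa> * (c ^ visits \<omega> n t * u s)" for r
        using mult_left_mono[OF drift[of s], of "c ^ visits \<omega> n t"] c
        by (simp add: F_def induced_chain_def mult_ac)
      then have "(\<integral>\<^sup>+r. ennreal (F \<omega> s a r) \<partial>rdist M \<theta> s a) \<le> (\<integral>\<^sup>+r. ennreal (\<kappa> * (c ^ visits \<omega> n t * u s)) \<partial>rdist M \<theta> s a)"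
        unfolding \<open>a = f s\<close> by (intro nn_integral_mono ennreal_leI) auto
      then show "(\<integral>\<^sup>+r. ennreal (F \<omega> s a r) \<partial>rdist M \<theta> s a) \<le> ennreal (\<kappa> * (c ^ visits \<omega> n t * u s))"
        by (simp add: emeasure_rdist_UNIV)
    qed (simp_all only: F_def visits_restrict, use c \<kappa> u0 in auto)
    also have "\<dots> = (\<integral>\<^sup>+\<omega>. ennreal \<kappa> * ennreal (\<Sum>s\<in>UNIV. pmf (next_state n \<omega>) s * (c ^ visits \<omega> n t * u s)) \<partial>law)"
      using c u0 \<kappa> by (intro nn_integral_cong)
        (auto simp: sum_distrib_left mult_ac sum_nonneg simp flip: ennreal_mult intro!: arg_cong[where f=ennreal] sum.cong)
    also have "\<dots> \<le> ennreal \<kappa> * (\<integral>\<^sup>+\<omega>. ennreal (\<Sum>s\<in>UNIV. pmf (next_state n \<omega>) s * (c ^ visits \<omega> n t * u s)) \<partial>law)"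
    proof -
      have "(\<lambda>\<omega>. \<Sum>s\<in>UNIV. pmf (next_state n \<omega>) s * (c ^ visits \<omega> n t * u s)) \<in> borel_measurable law"
      proof -
        have 1: "(\<lambda>\<omega>. \<Sum>s\<in>UNIV. pmf (next_state n \<omega>) s * (c ^ visits \<omega> n t * u s)) \<in> borel_measurable (past_space n)"
          by measurable
        have 2: "(\<lambda>\<omega>. \<Sum>s\<in>UNIV. pmf (next_state n \<omega>) s * (c ^ visits \<omega> n t * u s)) \<in> borel_measurable traj_space"
          by (rule measurable_traj_past[OF 1]) (simp only: next_state_restrict visits_restrict)
        then show ?thesis by (simp only: measurable_cong_sets[OF sets_law refl])
      qed
      from nn_integral_cmult[OF measurable_compose[OF this measurable_ennreal], of "ennreal \<kappa>"]
      show ?thesis by (rule eq_refl)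
    qed
    also have "\<dots> \<le> ennreal \<kappa> * ennreal (u s0 * \<kappa> ^ n)"
      by (intro mult_left_mono Suc.IH) auto
    also have "\<dots> = ennreal (u s0 * \<kappa> ^ Suc n)"
      using \<kappa> u0 by (simp add: mult_ac flip: ennreal_mult)
    finally show ?case .
  qed
  have "(\<integral>\<^sup>+\<omega>. ennreal (c ^ visits \<omega> n t) \<partial>law) \<le> ennreal (u s0 * \<kappa> ^ n)" for n
  proof -
    have "c ^ visits \<omega> n t \<le> (\<Sum>s\<in>UNIV. pmf (next_state n \<omega>) s * (c ^ visits \<omega> n t * u s))" for \<omega>
    proof -
      have "(\<Sum>s\<in>UNIV. pmf (next_state n \<omega>) s * c ^ visits \<omega> n t) \<le> (\<Sum>s\<in>UNIV. pmf (next_state n \<omega>) s * (c ^ visits \<omega> n t * u s))"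
        using c u by (intro sum_mono mult_left_mono) (auto simp: mult_le_cancel_left1)
      then show ?thesis by (simp add: sum_pmf_UNIV flip: sum_distrib_right)
    qed
    then show ?thesis
      by (intro order_trans[OF nn_integral_mono[OF ennreal_leI] V[of n]])
  qed
  then show ?thesis using \<kappa> u0 by blast
qed

section \<open>Thompson sampling\<close>

text \<open>Powers of \<open>c\<close> decrease in the exponent, so the comparison holds pointwise
  almost everywhere under the coupling; its marginals turn it into one between the two laws.\<close>

lemma (in param_mdp) visits_dominate_power:
  assumes adm: "admissible \<mu>" "admissible \<mu>'" and dom: "visits_dominate M \<theta> s0 t \<mu> \<mu>'"
    and c: "0 \<le> c" "c \<le> 1"
  shows "(\<integral>\<^sup>+\<omega>. ennreal (c ^ visits \<omega> n t) \<partial>traj_law M \<theta> \<mu> s0)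
    \<le> (\<integral>\<^sup>+\<omega>. ennreal (c ^ visits \<omega> n t) \<partial>traj_law M \<theta> \<mu>' s0)"
proof -
  interpret P: controlled_mdp M \<theta> \<mu> s0 by unfold_locales fact
  interpret P': controlled_mdp M \<theta> \<mu>' s0 by unfold_locales fact
  let ?f = "\<lambda>\<omega>. ennreal (c ^ visits \<omega> n t)"
  have f: "?f \<in> borel_measurable traj_space" by measurable
  from dom obtain Q where setsQ: "sets Q = sets (P.law \<Otimes>\<^sub>M P'.law)"
    and fst: "distr Q P.law fst = P.law" and snd: "distr Q P'.law snd = P'.law"
    and ae: "AE (\<omega>, \<omega>') in Q. \<forall>t'. visits \<omega> t' t \<ge> visits \<omega>' t' t"
    by (auto simp: visits_dominate_def coupling_def)
  have mf: "fst \<in> measurable Q P.law" and ms: "snd \<in> measurable Q P'.law"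
    by (simp_all add: measurable_cong_sets[OF setsQ refl])
  have "(\<integral>\<^sup>+\<omega>. ?f \<omega> \<partial>P.law) = (\<integral>\<^sup>+\<omega>. ?f \<omega> \<partial>distr Q P.law fst)" by (simp only: fst)
  also have "\<dots> = (\<integral>\<^sup>+x. ?f (fst x) \<partial>Q)"
    by (rule nn_integral_distr[OF mf]) (use f in \<open>simp add: measurable_cong_sets[OF P.sets_law refl]\<close>)
  also have "\<dots> \<le> (\<integral>\<^sup>+x. ?f (snd x) \<partial>Q)"
    using ae by (intro nn_integral_mono_AE)
      (auto simp: split_beta elim!: eventually_mono intro!: ennreal_leI power_decreasing c)
  also have "\<dots> = (\<integral>\<^sup>+\<omega>. ?f \<omega> \<partial>distr Q P'.law snd)"
    by (rule nn_integral_distr[OF ms, symmetric]) (use f in \<open>simp add: measurable_cong_sets[OF P'.sets_law refl]\<close>)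
  also have "\<dots> = (\<integral>\<^sup>+\<omega>. ?f \<omega> \<partial>P'.law)" by (simp only: snd)
  finally show ?thesis .
qed

section \<open>Posterior mass of the wrong parameters\<close>

context param_mdp
begin

definition evidence :: "'p pmf \<Rightarrow> nat \<Rightarrow> ('s, 'a) traj \<Rightarrow> 's \<Rightarrow> real" where
  "evidence prior n \<omega> s = (\<Sum>\<gamma>\<in>UNIV. likelihood M \<gamma> n \<omega> s * pmf prior \<gamma>)"

lemma evidence_nonneg: "0 \<le> evidence prior n \<omega> s"
  by (auto simp: evidence_def likelihood_nonneg intro!: sum_nonneg)

lemma pmf_posterior:
  "pmf (posterior M prior n \<omega> s) \<gamma> = (if evidence prior n \<omega> s = 0 then pmf prior \<gamma>
     else likelihood M \<gamma> n \<omega> s * pmf prior \<gamma> / evidence prior n \<omega> s)"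
proof (cases "evidence prior n \<omega> s = 0")
  case False
  let ?f = "\<lambda>\<gamma>. likelihood M \<gamma> n \<omega> s * pmf prior \<gamma> / evidence prior n \<omega> s"
  have nonneg: "0 \<le> ?f \<gamma>" for \<gamma> by (simp add: likelihood_nonneg evidence_nonneg)
  have "(\<Sum>\<gamma>\<in>UNIV. ?f \<gamma>) = 1"
    using False by (simp add: evidence_def flip: sum_divide_distrib)
  then have "(\<integral>\<^sup>+\<gamma>. ennreal (?f \<gamma>) \<partial>count_space UNIV) = 1"
    using nonneg by (simp add: nn_integral_count_space_finite)
  with nonneg have "pmf (embed_pmf ?f) \<gamma> = ?f \<gamma>" by (rule pmf_embed_pmf)
  with False show ?thesis by (simp add: posterior_def Let_def flip: evidence_def)
qed (simp add: posterior_def Let_def flip: evidence_def)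

lemma pmf_thompson:
  "pmf (thompson M mu_opt prior n \<omega> s) a
    = (\<Sum>\<gamma>\<in>{\<gamma>. mu_opt \<gamma> s = a}. pmf (posterior M prior n \<omega> s) \<gamma>)"
  unfolding thompson_def pmf_map by (simp add: measure_measure_pmf_finite vimage_def)

lemma admissible_thompson: "admissible (thompson M mu_opt prior)"
proof -
  have [measurable]: "(\<lambda>\<omega>. evidence prior n \<omega> s) \<in> borel_measurable (past_space n)" for n s
    unfolding evidence_def by measurable
  have "(\<lambda>\<omega>. pmf (posterior M prior n \<omega> s) \<gamma>) \<in> borel_measurable (past_space n)" for n s \<gamma>
    unfolding pmf_posterior by measurable
  then show ?thesis
    unfolding admissible_def pmf_thompson by (intro allI borel_measurable_sum)
qed

lemma set_pmf_thompson: "set_pmf (thompson M mu_opt prior n \<omega> s) \<subseteq> candidate_actions mu_opt s"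
  by (auto simp: thompson_def candidate_actions_def)

text \<open>A deviating action requires sampling a wrong parameter. Keeping only the \<theta> term
  of the evidence bounds the posterior of \<gamma> by its likelihood ratio over the prior mass of
  \<theta>; it is also at most 1, and a ratio up to 1 is at most its square root.\<close>

lemma thompson_deviation_le:
  assumes prior: "pmf prior \<theta> > 0" and pos: "likelihood M \<theta> n \<omega> s \<noteq> 0"
  shows "1 - pmf (thompson M mu_opt prior n \<omega> s) (mu_opt \<theta> s)
    \<le> 1 / pmf prior \<theta> * (\<Sum>\<gamma>\<in>UNIV - {\<theta>}. min 1 (sqrt (likelihood M \<gamma> n \<omega> s / likelihood M \<theta> n \<omega> s)))"
proof -
  let ?l = "\<lambda>\<gamma>. likelihood M \<gamma> n \<omega> s" and ?Z = "evidence prior n \<omega> s"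
  have l: "0 < ?l \<theta>" using pos likelihood_nonneg[of \<theta> n \<omega> s] by simp
  have term_le: "?l \<gamma> * pmf prior \<gamma> \<le> ?Z" for \<gamma>
    unfolding evidence_def by (rule member_le_sum) (auto simp: likelihood_nonneg)
  have lp: "0 < ?l \<theta> * pmf prior \<theta>" using l prior by simp
  then have Z: "0 < ?Z" using term_le[of \<theta>] by linarith
  have "1 - pmf (thompson M mu_opt prior n \<omega> s) (mu_opt \<theta> s) \<le> 1 - pmf (posterior M prior n \<omega> s) \<theta>"
    unfolding pmf_thompson by (intro diff_left_mono member_le_sum) auto
  also have "\<dots> = (\<Sum>\<gamma>\<in>UNIV - {\<theta>}. pmf (posterior M prior n \<omega> s) \<gamma>)"
    using sum_pmf_UNIV[of "posterior M prior n \<omega> s"] by (simp add: sum.remove[of UNIV \<theta>])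
  also have "\<dots> \<le> (\<Sum>\<gamma>\<in>UNIV - {\<theta>}. 1 / pmf prior \<theta> * min 1 (sqrt (?l \<gamma> / ?l \<theta>)))"
  proof (rule sum_mono)
    fix \<gamma>
    define x where "x = ?l \<gamma> / ?l \<theta>"
    have x: "0 \<le> x" using l by (simp add: x_def likelihood_nonneg)
    have post: "pmf (posterior M prior n \<omega> s) \<gamma> = ?l \<gamma> * pmf prior \<gamma> / ?Z"
      using Z by (simp add: pmf_posterior)
    have "pmf (posterior M prior n \<omega> s) \<gamma> \<le> 1" by (rule pmf_le_1)
    also have "1 \<le> 1 / pmf prior \<theta>" using prior by (simp add: pmf_le_1)
    finally have le1: "pmf (posterior M prior n \<omega> s) \<gamma> \<le> 1 / pmf prior \<theta>" .
    have "?l \<gamma> * pmf prior \<gamma> / ?Z \<le> ?l \<gamma> * 1 / (?l \<theta> * pmf prior \<theta>)"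
      using lp term_le[of \<theta>] by (intro frac_le mult_left_mono) (auto simp: likelihood_nonneg pmf_le_1)
    then have lex: "pmf (posterior M prior n \<omega> s) \<gamma> \<le> 1 / pmf prior \<theta> * x"
      by (simp add: post x_def mult_ac)
    show "pmf (posterior M prior n \<omega> s) \<gamma> \<le> 1 / pmf prior \<theta> * min 1 (sqrt (?l \<gamma> / ?l \<theta>))"
    proof (cases "x \<le> 1")
      case True
      have "x \<le> sqrt x" using x True by (intro real_le_rsqrt) (simp add: power2_eq_square mult_left_le)
      then have "1 / pmf prior \<theta> * x \<le> 1 / pmf prior \<theta> * sqrt x"
        using prior by (intro mult_left_mono) auto
      with lex le1 True x show ?thesis by (simp add: min_def flip: x_def)
    next
      case False
      then show ?thesis using le1 by (simp add: min_def flip: x_def)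
    qed
  qed
  finally show ?thesis by (simp only: sum_distrib_left)
qed

end

text \<open>Combines the estimates at one time \<open>n\<close> for a free threshold
  \<open>l\<close>: the normalised ratio contributes \<open>l\<close>, and the discounted visit
  count contributes \<open>v / l\<close> in the manner of Markov's inequality.\<close>

lemma (in controlled_mdp) deviation_bound:
  assumes dev: "\<And>\<omega> s. likelihood M \<theta> n \<omega> s \<noteq> 0 \<Longrightarrow>
      1 - pmf (\<mu> n (restrict \<omega> {0..<n}) s) (f s) \<le> K * (\<Sum>\<gamma>\<in>UNIV - {\<theta>}. min 1 (sqrt_ratio \<gamma> n \<omega> s))"
    and super: "\<And>\<gamma>. \<gamma> \<noteq> \<theta> \<Longrightarrow>
      (\<integral>\<^sup>+\<omega>. ennreal ((\<Sum>s\<in>UNIV. pmf (next_state n \<omega>) s * sqrt_ratio \<gamma> n \<omega> s) / c ^ visits \<omega> n t) \<partial>law) \<le> 1"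
    and vis: "(\<integral>\<^sup>+\<omega>. ennreal (c ^ visits \<omega> n t) \<partial>law) \<le> ennreal v"
    and pos: "0 < c" "0 \<le> K" "0 \<le> v" "0 < l"
  shows "law.prob {\<omega>. action \<omega> n \<noteq> f (state \<omega> n)} \<le> K * (real (card (UNIV - {\<theta>})) * (l + v / l))"
proof -
  define Y where "Y \<gamma> \<omega> = (\<Sum>s\<in>UNIV. pmf (next_state n \<omega>) s * sqrt_ratio \<gamma> n \<omega> s) / c ^ visits \<omega> n t" for \<gamma> \<omega>
  \<comment> \<open>The conditional probability that the true likelihood vanishes; on that event the
    deviation probability is only bounded by 1.\<close>
  define G where "G \<omega> = (\<Sum>s\<in>UNIV. pmf (next_state n \<omega>) s * (if likelihood M \<theta> n \<omega> s = 0 then 1 else 0 :: real))" for \<omega>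
  define N where "N \<omega> = c ^ visits \<omega> n t" for \<omega> :: "('s, 'a) traj"
  have N: "0 < N \<omega>" for \<omega> using pos by (simp add: N_def)
  have Y: "0 \<le> Y \<gamma> \<omega>" for \<gamma> \<omega> using pos by (auto simp: Y_def sqrt_ratio_nonneg intro!: sum_nonneg divide_nonneg_nonneg)
  have G: "0 \<le> G \<omega>" for \<omega> by (auto simp: G_def intro!: sum_nonneg)
  have "G \<in> borel_measurable (past_space n)" unfolding G_def by measurable
  then have "G \<in> borel_measurable traj_space"
    by (rule measurable_traj_past) (simp only: G_def next_state_restrict likelihood_restrict)
  then have mG: "G \<in> borel_measurable law" by (simp only: measurable_cong_sets[OF sets_law refl])
  have "Y \<gamma> \<in> borel_measurable (past_space n)" for \<gamma> unfolding Y_def sqrt_ratio_def by measurable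
  then have "Y \<gamma> \<in> borel_measurable traj_space" for \<gamma>
    by (rule measurable_traj_past) (simp only: Y_def sqrt_ratio_def next_state_restrict likelihood_restrict visits_restrict)
  then have mY: "Y \<gamma> \<in> borel_measurable law" for \<gamma> by (simp only: measurable_cong_sets[OF sets_law refl])
  have "N \<in> borel_measurable traj_space" unfolding N_def by measurable
  then have mN: "N \<in> borel_measurable law" by (simp only: measurable_cong_sets[OF sets_law refl])
  note [measurable] = mG mY mN
  \<comment> \<open>Here \<open>x\<close> is the root of the likelihood ratio and \<open>y\<close>
    the discount. If \<open>y\<close> is at most \<open>l\<close>, then
    \<open>x = y * (x / y)\<close> is bounded by the first term; otherwise the second term exceeds
    1.\<close>
  have min_le: "min 1 x \<le> l * (x / y) + y / l" if "0 \<le> x" "0 < y" for x y :: real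
  proof (cases "y \<le> l")
    case True
    then have "x * y \<le> x * l" using that by (intro mult_left_mono)
    then have "x \<le> l * (x / y)" using that by (simp add: field_simps)
    moreover have "0 \<le> y / l" using that pos by simp
    ultimately show ?thesis by linarith
  next
    case False
    then have "1 \<le> y / l" using pos by simp
    moreover have "0 \<le> l * (x / y)" using that pos by simp
    ultimately show ?thesis by linarith
  qed
  have pointwise: "(\<Sum>s\<in>UNIV. pmf (next_state n \<omega>) s * (1 - pmf (\<mu> n (restrict \<omega> {0..<n}) s) (f s)))
      \<le> G \<omega> + K * (\<Sum>\<gamma>\<in>UNIV - {\<theta>}. l * Y \<gamma> \<omega> + N \<omega> / l)" for \<omega>
  proof -
    let ?b = "\<lambda>s. (if likelihood M \<theta> n \<omega> s = 0 then 1 else 0) + K * (\<Sum>\<gamma>\<in>UNIV - {\<theta>}. l * (sqrt_ratio \<gamma> n \<omega> s / N \<omega>) + N \<omega> / l)"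
    have "1 - pmf (\<mu> n (restrict \<omega> {0..<n}) s) (f s) \<le> ?b s" for s
    proof -
      have le: "K * (\<Sum>\<gamma>\<in>UNIV - {\<theta>}. min 1 (sqrt_ratio \<gamma> n \<omega> s))
        \<le> K * (\<Sum>\<gamma>\<in>UNIV - {\<theta>}. l * (sqrt_ratio \<gamma> n \<omega> s / N \<omega>) + N \<omega> / l)"
        using pos N by (intro mult_left_mono sum_mono min_le sqrt_ratio_nonneg)
      have nn: "0 \<le> K * (\<Sum>\<gamma>\<in>UNIV - {\<theta>}. min 1 (sqrt_ratio \<gamma> n \<omega> s))"
        using pos by (intro mult_nonneg_nonneg sum_nonneg) (auto simp: sqrt_ratio_nonneg)
      have one: "1 - pmf (\<mu> n (restrict \<omega> {0..<n}) s) (f s) \<le> 1" by simp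
      show ?thesis
      proof (cases "likelihood M \<theta> n \<omega> s = 0")
        case True
        then show ?thesis using add_mono[OF one order_trans[OF nn le]] by simp
      next
        case False
        from order_trans[OF dev[OF this] le] False show ?thesis by simp
      qed
    qed
    then have "(\<Sum>s\<in>UNIV. pmf (next_state n \<omega>) s * (1 - pmf (\<mu> n (restrict \<omega> {0..<n}) s) (f s)))
      \<le> (\<Sum>s\<in>UNIV. pmf (next_state n \<omega>) s * ?b s)"
      by (intro sum_mono mult_left_mono) auto
    also have "\<dots> = G \<omega> + K * (\<Sum>s\<in>UNIV. \<Sum>\<gamma>\<in>UNIV - {\<theta>}. pmf (next_state n \<omega>) s * (l * (sqrt_ratio \<gamma> n \<omega> s / N \<omega>) + N \<omega> / l))"
      unfolding G_def distrib_left sum.distrib sum_distrib_left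
      by (simp only: mult.left_commute)
    also have "(\<Sum>s\<in>UNIV. \<Sum>\<gamma>\<in>UNIV - {\<theta>}. pmf (next_state n \<omega>) s * (l * (sqrt_ratio \<gamma> n \<omega> s / N \<omega>) + N \<omega> / l))
      = (\<Sum>\<gamma>\<in>UNIV - {\<theta>}. \<Sum>s\<in>UNIV. pmf (next_state n \<omega>) s * (l * (sqrt_ratio \<gamma> n \<omega> s / N \<omega>) + N \<omega> / l))"
      by (rule sum.swap)
    also have "\<dots> = (\<Sum>\<gamma>\<in>UNIV - {\<theta>}. l * Y \<gamma> \<omega> + N \<omega> / l)"
    proof (rule sum.cong[OF refl])
      fix \<gamma>
      have "(\<Sum>s\<in>UNIV. pmf (next_state n \<omega>) s * (l * (sqrt_ratio \<gamma> n \<omega> s / N \<omega>) + N \<omega> / l))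
        = (\<Sum>s\<in>UNIV. l * (pmf (next_state n \<omega>) s * sqrt_ratio \<gamma> n \<omega> s / N \<omega>)) + (\<Sum>s\<in>UNIV. pmf (next_state n \<omega>) s) * (N \<omega> / l)"
        unfolding sum_distrib_right sum.distrib[symmetric] by (intro sum.cong) (simp_all add: distrib_left mult_ac)
      then show "(\<Sum>s\<in>UNIV. pmf (next_state n \<omega>) s * (l * (sqrt_ratio \<gamma> n \<omega> s / N \<omega>) + N \<omega> / l)) = l * Y \<gamma> \<omega> + N \<omega> / l"
        by (simp add: sum_pmf_UNIV Y_def N_def sum_divide_distrib sum_distrib_left)
    qed
    finally show ?thesis .
  qed
  have "ennreal (law.prob {\<omega>. action \<omega> n \<noteq> f (state \<omega> n)})
      \<le> (\<integral>\<^sup>+\<omega>. ennreal (G \<omega> + K * (\<Sum>\<gamma>\<in>UNIV - {\<theta>}. l * Y \<gamma> \<omega> + N \<omega> / l)) \<partial>law)"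
    unfolding prob_deviation by (intro nn_integral_mono ennreal_leI pointwise)
  also have "\<dots> = (\<integral>\<^sup>+\<omega>. ennreal (G \<omega>) + ennreal K * (\<Sum>\<gamma>\<in>UNIV - {\<theta>}. ennreal l * ennreal (Y \<gamma> \<omega>) + ennreal (1 / l) * ennreal (N \<omega>)) \<partial>law)"
  proof (rule nn_integral_cong)
    fix \<omega>
    have eq: "ennreal l * ennreal (Y \<gamma> \<omega>) + ennreal (1 / l) * ennreal (N \<omega>) = ennreal (l * Y \<gamma> \<omega> + N \<omega> / l)" for \<gamma>
      using pos Y N[of \<omega>] by (simp flip: ennreal_mult ennreal_plus)
    have nn: "0 \<le> l * Y \<gamma> \<omega> + N \<omega> / l" for \<gamma>
      using pos Y[of \<gamma> \<omega>] N[of \<omega>] by simp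
    show "ennreal (G \<omega> + K * (\<Sum>\<gamma>\<in>UNIV - {\<theta>}. l * Y \<gamma> \<omega> + N \<omega> / l))
      = ennreal (G \<omega>) + ennreal K * (\<Sum>\<gamma>\<in>UNIV - {\<theta>}. ennreal l * ennreal (Y \<gamma> \<omega>) + ennreal (1 / l) * ennreal (N \<omega>))"
      unfolding eq using pos G[of \<omega>] nn
      by (simp add: sum_nonneg flip: ennreal_mult ennreal_plus)
  qed
  also have "\<dots> = (\<integral>\<^sup>+\<omega>. ennreal (G \<omega>) \<partial>law) + ennreal K * (\<Sum>\<gamma>\<in>UNIV - {\<theta>}.
      ennreal l * (\<integral>\<^sup>+\<omega>. ennreal (Y \<gamma> \<omega>) \<partial>law) + ennreal (1 / l) * (\<integral>\<^sup>+\<omega>. ennreal (N \<omega>) \<partial>law))"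
    by (simp add: nn_integral_add nn_integral_cmult nn_integral_sum)
  \<comment> \<open>The means of \<open>G\<close>, \<open>Y\<close> and \<open>N\<close> are at most
    0, 1 and \<open>v\<close>.\<close>
  also have "\<dots> \<le> 0 + ennreal K * (\<Sum>\<gamma>\<in>UNIV - {\<theta>}. ennreal l * 1 + ennreal (1 / l) * ennreal v)"
    using super vis nn_integral_likelihood_zero[of n]
    by (intro add_mono mult_left_mono sum_mono) (auto simp: Y_def G_def N_def)
  also have "\<dots> = ennreal (K * (real (card (UNIV - {\<theta>})) * (l + v / l)))"
  proof -
    have "ennreal l * 1 + ennreal (1 / l) * ennreal v = ennreal (l + v / l)"
      using pos by (simp flip: ennreal_mult ennreal_plus)
    moreover have "0 \<le> l + v / l" using pos by simp
    ultimately show ?thesis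
      using pos by (simp only: sum_constant ennreal_of_nat_eq_real_of_nat ennreal_mult
          mult_nonneg_nonneg of_nat_0_le_iff add_0_left)
  qed
  finally show ?thesis
    using pos by (subst (asm) ennreal_le_iff) auto
qed


lemma (in param_mdp) thompson_deviation_summable:
  fixes mu_opt :: "'p \<Rightarrow> 's \<Rightarrow> 'a"
  assumes prior: "pmf prior \<theta> > 0"
    and inf: "\<And>\<gamma>. informative M t (mu_opt \<gamma> t)"
    and bar: "\<And>s. reachable (induced_chain M \<theta> mu_bar) s t"
    and dom: "visits_dominate M \<theta> s0 t (thompson M mu_opt prior) (stationary mu_bar)"
  shows "summable (\<lambda>n. measure (traj_law M \<theta> (thompson M mu_opt prior) s0)
    {\<omega>. action \<omega> n \<noteq> mu_opt \<theta> (state \<omega> n)})"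
proof -
  interpret controlled_mdp M \<theta> "thompson M mu_opt prior" s0
    by unfold_locales (rule admissible_thompson)
  \<comment> \<open>All candidate actions at \<open>t\<close> must be covered, since the sampled
    parameter may be any. The element \<open>1/2\<close> keeps \<open>c\<close> positive and the set
    nonempty even for a single parameter.\<close>
  define A where "A = insert (1/2) ((\<lambda>(\<gamma>, \<gamma>'). reward_affinity \<theta> \<gamma> t (mu_opt \<gamma>' t) * state_affinity \<theta> \<gamma> t (mu_opt \<gamma>' t))
    ` ((UNIV - {\<theta>}) \<times> UNIV))"
  define c where "c = Max A"
  have A: "finite A" by (simp add: A_def)
  have "1/2 \<le> c" unfolding c_def by (rule Max_ge[OF A]) (simp add: A_def)
  then have c0: "0 < c" by simp
  have c1: "c < 1"
    unfolding c_def using A informative_affinity[OF inf] by (subst Max_less_iff) (auto simp: A_def)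
  have aff: "reward_affinity \<theta> \<gamma> t a * state_affinity \<theta> \<gamma> t a \<le> c"
    if "\<gamma> \<noteq> \<theta>" "a \<in> set_pmf (thompson M mu_opt prior n \<omega> t)" for \<gamma> a n \<omega>
  proof -
    from that(2) obtain \<gamma>' where "a = mu_opt \<gamma>' t" by (auto simp: thompson_def)
    with that(1) have "reward_affinity \<theta> \<gamma> t a * state_affinity \<theta> \<gamma> t a \<in> A" by (auto simp: A_def)
    then show ?thesis unfolding c_def by (rule Max_ge[OF A])
  qed
  obtain C \<kappa> where \<kappa>: "0 \<le> \<kappa>" "\<kappa> < 1" and C: "0 \<le> C" and
    vis: "\<And>n. (\<integral>\<^sup>+\<omega>. ennreal (c ^ visits \<omega> n t) \<partial>traj_law M \<theta> (stationary mu_bar) s0) \<le> ennreal (C * \<kappa> ^ n)"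
    using visits_stationary_bound[OF less_imp_le[OF c0] c1 bar] by blast
  \<comment> \<open>With \<kappa> at most the square of \<open>l\<close>, both \<open>l ^ n\<close>
    and \<open>\<kappa> ^ n / l ^ n\<close> are at most \<open>l ^ n\<close>. The \<open>1/2\<close>
    keeps \<open>l\<close> positive when \<kappa> is 0.\<close>
  define l where "l = sqrt (max \<kappa> (1/2))"
  have l: "0 < l" "l < 1" "\<kappa> \<le> l\<^sup>2"
    using \<kappa> by (auto simp: l_def)
  define K where "K = 1 / pmf prior \<theta> * real (card (UNIV - {\<theta>}))"
  have "law.prob {\<omega>. action \<omega> n \<noteq> mu_opt \<theta> (state \<omega> n)} \<le> K * (1 + C) * l ^ n" for n
  proof -
    have "law.prob {\<omega>. action \<omega> n \<noteq> mu_opt \<theta> (state \<omega> n)}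
      \<le> 1 / pmf prior \<theta> * (real (card (UNIV - {\<theta>})) * (l ^ n + C * \<kappa> ^ n / l ^ n))"
    proof (rule deviation_bound)
      fix \<omega> s assume "likelihood M \<theta> n \<omega> s \<noteq> 0"
      then show "1 - pmf (thompson M mu_opt prior n (restrict \<omega> {0..<n}) s) (mu_opt \<theta> s)
        \<le> 1 / pmf prior \<theta> * (\<Sum>\<gamma>\<in>UNIV - {\<theta>}. min 1 (sqrt_ratio \<gamma> n \<omega> s))"
        using thompson_deviation_le[OF prior, of n "restrict \<omega> {0..<n}" s mu_opt]
        by (simp only: sqrt_ratio_def likelihood_restrict not_False_eq_True True_implies_equals)
    next
      fix \<gamma> assume "\<gamma> \<noteq> \<theta>"
      then show "(\<integral>\<^sup>+\<omega>. ennreal ((\<Sum>s\<in>UNIV. pmf (next_state n \<omega>) s * sqrt_ratio \<gamma> n \<omega> s) / c ^ visits \<omega> n t) \<partial>law) \<le> 1"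
        using c0 c1 by (intro hellinger_supermartingale aff) auto
    next
      have "admissible (stationary mu_bar)" by (simp add: admissible_def stationary_def)
      from visits_dominate_power[OF admissible_thompson this dom, of c n] vis[of n] c0 c1
      show "(\<integral>\<^sup>+\<omega>. ennreal (c ^ visits \<omega> n t) \<partial>law) \<le> ennreal (C * \<kappa> ^ n)" by simp
    qed (use c0 C \<kappa> l in auto)
    also have "\<dots> \<le> 1 / pmf prior \<theta> * (real (card (UNIV - {\<theta>})) * (l ^ n + C * l ^ n))"
    proof -
      have "\<kappa> ^ n \<le> (l\<^sup>2) ^ n" using \<kappa> l by (intro power_mono) auto
      also have "\<dots> = l ^ n * l ^ n" by (simp add: power2_eq_square power_mult_distrib)
      finally have "C * \<kappa> ^ n \<le> C * (l ^ n * l ^ n)" using C by (rule mult_left_mono)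
      then have "C * \<kappa> ^ n / l ^ n \<le> C * l ^ n" using l by (simp add: divide_le_eq mult_ac)
      then show ?thesis by (intro mult_left_mono add_left_mono) auto
    qed
    also have "\<dots> = K * (1 + C) * l ^ n"
      unfolding K_def by (simp only: distrib_left distrib_right mult_1_left mult_1_right mult_ac)
    finally show ?thesis .
  qed
  then show ?thesis
    using l by (intro summable_comparison_test[OF _ summable_mult[OF summable_geometric[of l]]]) auto
qed

section \<open>Bounded cumulative regret\<close>

theorem theorem3:
  fixes M :: "('s::finite, 'a::finite, 'p::finite) pmdp"
    and mu_opt :: "'p \<Rightarrow> 's \<Rightarrow> 'a"
    and prior :: "'p pmf"
    and s_star s0 :: 's
    and mu_bar :: "'s \<Rightarrow> 'a"
  assumes "param_mdp M"
    and "\<And>\<theta>. optimal_policy M \<theta> (stationary (mu_opt \<theta>))"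
    and "\<And>\<theta>. pmf prior \<theta> > 0"
    and "\<And>\<theta>. ergodic_unichain (induced_chain M \<theta> (mu_opt \<theta>))"
    and "\<And>\<theta>. informative M s_star (mu_opt \<theta> s_star)"
    and "\<And>\<theta>. ergodic_chain (induced_chain M \<theta> mu_bar)"
    and "\<And>\<theta> \<mu>. \<mu> \<in> candidate_policies mu_opt \<Longrightarrow>
           visits_dominate M \<theta> s0 s_star \<mu> (stationary mu_bar)"
  shows "worst_case_average_regret M mu_opt prior s0 \<in> O(\<lambda>T. 1 / real T)"
proof -
  interpret param_mdp M by fact
  let ?ts = "thompson M mu_opt prior"
  have "\<exists>B. \<forall>T. \<bar>expected_reward M \<theta> (stationary (mu_opt \<theta>)) s0 T - expected_reward M \<theta> ?ts s0 T\<bar> \<le> B" for \<theta>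
  proof -
    interpret O: controlled_mdp M \<theta> "stationary (mu_opt \<theta>)" s0
      by unfold_locales (simp add: admissible_def stationary_def)
    interpret TS: controlled_mdp M \<theta> ?ts s0
      by unfold_locales (rule admissible_thompson)
    obtain g h where "\<And>s. rmean M \<theta> s (mu_opt \<theta> s) = g + h s - (\<Sum>s'\<in>UNIV. pmf (induced_chain M \<theta> (mu_opt \<theta>) s) s' * h s')"
      using poisson_equation[OF assms(4), of "\<lambda>s. rmean M \<theta> s (mu_opt \<theta> s)"] by blast
    \<comment> \<open>Both rewards are compared with the same line \<open>T * g\<close>. The
      stationary policy never deviates from itself, so its distance to that line is bounded
      outright.\<close>
    note near = O.expected_reward_near[OF this] TS.expected_reward_near[OF this]
    from near(1) obtain C1 where C1: "\<And>T. \<bar>expected_reward M \<theta> (stationary (mu_opt \<theta>)) s0 T - real T * g\<bar> \<le> C1"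
      by (auto simp: prob_deviation_stationary)
    let ?p = "\<lambda>n. TS.law.prob {\<omega>. action \<omega> n \<noteq> mu_opt \<theta> (state \<omega> n)}"
    from near(2) obtain C2 where C2: "\<And>T. \<bar>expected_reward M \<theta> ?ts s0 T - real T * g\<bar> \<le> C2 * (1 + (\<Sum>t<T. ?p t))"
      by blast
    have "?ts \<in> candidate_policies mu_opt"
      using admissible_thompson set_pmf_thompson by (auto simp: candidate_policies_def)
    moreover have "reachable (induced_chain M \<theta> mu_bar) s s_star" for s
      using assms(6) by (simp add: ergodic_chain_def)
    ultimately have "summable ?p"
      using assms(3,5,7) by (intro thompson_deviation_summable[where t=s_star and mu_bar=mu_bar]) auto
    then have "(\<Sum>t<T. ?p t) \<le> suminf ?p" for T
      by (intro sum_le_suminf) auto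
    \<comment> \<open>The sign of \<open>C2\<close> is unknown, hence the absolute value before
      partial sums are replaced by the full series.\<close>
    then have le: "C2 * (1 + (\<Sum>t<T. ?p t)) \<le> \<bar>C2\<bar> * (1 + suminf ?p)" for T
      by (intro mult_mono) (auto simp: sum_nonneg add_nonneg_nonneg)
    have "\<bar>expected_reward M \<theta> (stationary (mu_opt \<theta>)) s0 T - expected_reward M \<theta> ?ts s0 T\<bar>
      \<le> C1 + \<bar>C2\<bar> * (1 + suminf ?p)" for T
      using C1[of T] C2[of T] le[of T] by linarith
    then show ?thesis by blast
  qed
  then obtain B where B: "\<And>\<theta> T. \<bar>expected_reward M \<theta> (stationary (mu_opt \<theta>)) s0 T - expected_reward M \<theta> ?ts s0 T\<bar> \<le> B \<theta>"
    by metis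
  \<comment> \<open>Finiteness of the parameter set makes the worst case attained and
    \<open>Max (range B)\<close> a common constant. At \<open>T = 0\<close> both sides are 0, as
    division by zero gives 0.\<close>
  have "\<bar>worst_case_average_regret M mu_opt prior s0 T\<bar> \<le> Max (range B) * \<bar>1 / real T\<bar>" for T
  proof -
    have "worst_case_average_regret M mu_opt prior s0 T \<in> range (\<lambda>\<theta>. average_regret M mu_opt prior s0 \<theta> T)"
      unfolding worst_case_average_regret_def by (rule Max_in) auto
    then obtain \<theta> where "worst_case_average_regret M mu_opt prior s0 T = average_regret M mu_opt prior s0 \<theta> T" by blast
    moreover have "B \<theta> \<le> Max (range B)" by (rule Max_ge) auto
    note order_trans[OF B[of \<theta> T] this]
    then have "\<bar>average_regret M mu_opt prior s0 \<theta> T\<bar> \<le> Max (range B) * \<bar>1 / real T\<bar>"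
      by (simp add: average_regret_def divide_right_mono)
    ultimately show ?thesis by simp
  qed
  then show ?thesis by (intro bigoI[of _ "Max (range B)"]) auto
qed

end
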